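(* Let $\mu$ be a positive finite Borel measure on $[0,1)$ and let $v,w$ be weights on $\mathbb{D}$ with $1/v\in L_1([0,1),\mu)$. Consider: (i) $\lim_{r\to1^-}w(r)\int_0^1\frac{d\mu(t)}{v(t)(1-tr)}=0$; (ii) $I_\mu:H^\infty_v\to H^0_w$ is (well defined and) compact; (iii) $I_\mu:H^\infty_v\to H^\infty_w$ is (well defined and) compact and $I_\mu(1)\in H^0_w$; (iv) $I_\mu:H^\infty_v\to H^0_w$ is (well defined and) continuous. Then (i) implies (ii), (ii) implies (iii), and (iii) implies (iv). If in addition $v$ is essential, the four conditions are equivalent.
   Context: $\mathbb{D}$ is the open unit disc and $H(\mathbb{D})$ the holomorphic functions on $\mathbb{D}$. A weight is a function $v:\mathbb{D}\to(0,\infty)$ that is radial, continuous, non-increasing in $|z|$, with $\lim_{r\to1^-}v(r)=0$. $H^\infty_v=\{f\in H(\mathbb{D}):\|f\|_v:=\sup_{z}v(z)|f(z)|<\infty\}$ and $H^0_v=\{f\in H^\infty_v:\lim_{|z|\to1^-}v(z)|f(z)|=0\}$, with norm $\|\cdot\|_v$. A weight $v$ is essential if there is $c>0$ with $c/v(z)\le\sup\{|f(z)|:\|f\|_v\le1\}\le1/v(z)$ for all $z\in\mathbb{D}$. $I_\mu(f)(z)=\int_0^1\frac{f(t)}{1-tz}\,d\mu(t)$ whenever this defines a holomorphic function on $\mathbb{D}$. *)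

theory Defs
  imports "HOL-Analysis.Analysis"
begin

definition is_weight :: "(complex \<Rightarrow> real) \<Rightarrow> bool" where
  "is_weight v \<longleftrightarrow>
     (\<forall>z\<in>ball 0 1. v z > 0) \<and>
     (\<forall>z\<in>ball 0 1. v z = v (complex_of_real (cmod z))) \<and>
     continuous_on (ball 0 1) v \<and>
     (\<forall>z\<in>ball 0 1. \<forall>z'\<in>ball 0 1. cmod z \<le> cmod z' \<longrightarrow> v z' \<le> v z) \<and>
     ((\<lambda>r. v (complex_of_real r)) \<longlongrightarrow> 0) (at_left 1)"

definition Hinf :: "(complex \<Rightarrow> real) \<Rightarrow> (complex \<Rightarrow> complex) set" where
  "Hinf v = {f. f holomorphic_on ball 0 1 \<and> (\<exists>C. \<forall>z\<in>ball 0 1. v z * cmod (f z) \<le> C)}"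

definition wnorm :: "(complex \<Rightarrow> real) \<Rightarrow> (complex \<Rightarrow> complex) \<Rightarrow> real" where
  "wnorm v f = (SUP z\<in>ball 0 1. v z * cmod (f z))"

definition H0 :: "(complex \<Rightarrow> real) \<Rightarrow> (complex \<Rightarrow> complex) set" where
  "H0 v = {f \<in> Hinf v. \<forall>e>0. \<exists>r<1. \<forall>z. r < cmod z \<and> cmod z < 1 \<longrightarrow> v z * cmod (f z) < e}"

definition essential_weight :: "(complex \<Rightarrow> real) \<Rightarrow> bool" where
  "essential_weight v \<longleftrightarrow> (\<exists>c>0. \<forall>z\<in>ball 0 1.
     c / v z \<le> (SUP f\<in>{f\<in>Hinf v. wnorm v f \<le> 1}. cmod (f z)) \<and>
     (SUP f\<in>{f\<in>Hinf v. wnorm v f \<le> 1}. cmod (f z)) \<le> 1 / v z)"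

definition Imu :: "real measure \<Rightarrow> (complex \<Rightarrow> complex) \<Rightarrow> complex \<Rightarrow> complex" where
  "Imu mu f z = (LINT t|mu. f (complex_of_real t) / (1 - complex_of_real t * z))"

definition Imu_maps :: "real measure \<Rightarrow> (complex \<Rightarrow> real) \<Rightarrow> (complex \<Rightarrow> complex) set \<Rightarrow> bool" where
  "Imu_maps mu v Y \<longleftrightarrow> (\<forall>f\<in>Hinf v.
     (\<forall>z\<in>ball 0 1. integrable mu (\<lambda>t. f (complex_of_real t) / (1 - complex_of_real t * z)))
     \<and> Imu mu f \<in> Y)"

text \<open>Compactness of \<open>T : (H\<^sup>\<infinity>_v, \<parallel>.\<parallel>_v) \<rightarrow> (Y, \<parallel>.\<parallel>_w)\<close>: the image of the unit ball is
  relatively compact in the metric space \<open>Y\<close>, expressed sequentially.\<close>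
definition compact_op :: "(complex \<Rightarrow> real) \<Rightarrow> (complex \<Rightarrow> real) \<Rightarrow> (complex \<Rightarrow> complex) set
    \<Rightarrow> ((complex \<Rightarrow> complex) \<Rightarrow> (complex \<Rightarrow> complex)) \<Rightarrow> bool" where
  "compact_op v w Y T \<longleftrightarrow>
     (\<forall>F. (\<forall>n. F n \<in> Hinf v \<and> wnorm v (F n) \<le> 1) \<longrightarrow>
        (\<exists>(\<phi>::nat \<Rightarrow> nat) g. strict_mono \<phi> \<and> g \<in> Y \<and>
           (\<lambda>n. wnorm w (\<lambda>z. T (F (\<phi> n)) z - g z)) \<longlonglongrightarrow> 0))"

definition continuous_op :: "(complex \<Rightarrow> real) \<Rightarrow> (complex \<Rightarrow> real)
    \<Rightarrow> ((complex \<Rightarrow> complex) \<Rightarrow> (complex \<Rightarrow> complex)) \<Rightarrow> bool" where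
  "continuous_op v w T \<longleftrightarrow>
     (\<forall>f\<in>Hinf v. \<forall>e>0. \<exists>d>0. \<forall>g\<in>Hinf v.
        wnorm v (\<lambda>z. g z - f z) < d \<longrightarrow> wnorm w (\<lambda>z. T g z - T f z) < e)"

end

theory Submission
  imports Defs "HOL-Complex_Analysis.Complex_Analysis"
begin

text \<open>
  Write \<open>K r = \<integral> d\<mu>(t) / (v(t) (1 - t r))\<close>, so that \<open>\<bar>I\<^sub>\<mu> f z\<bar> \<le> \<parallel>f\<parallel> K \<bar>z\<bar>\<close>. If \<open>w K\<close> vanishes at the
  boundary, a bounded sequence has a pointwise convergent subsequence by Montel's theorem; the
  images are uniformly small near the boundary and converge uniformly on smaller discs by dominated
  convergence in \<open>L\<^sub>1(\<mu>)\<close>. Under (iii), \<open>I\<^sub>\<mu>\<close> maps the bounded dilations of \<open>f\<close> into \<open>H\<^sup>0_w\<close>, and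
  compactness identifies \<open>I\<^sub>\<mu> f\<close> with a norm limit of a subsequence of these images.

  For (iv) \<open>\<Longrightarrow>\<close> (i) it is enough to find one \<open>f\<close> in \<open>H\<^sup>\<infinity>_v\<close> with \<open>f \<ge> c / v\<close> on \<open>[0,1)\<close>. For essential
  \<open>v\<close>, the maximum principle on annuli shows that \<open>1 / v\<close> is comparable to the supremum of the
  monomials \<open>b\<^sub>k r\<^sup>k\<close> lying below it and touching it. A greedy selection, in the spirit of Erdos and
  Kovari, thins these out to a lacunary family that still has a comparable maximum but whose terms
  decay geometrically away from the largest ones, so that its sum is comparable to \<open>1 / v\<close>.
\<close>

section \<open>Lacunary selection of monomials\<close>

text \<open>The intended instance is \<open>V r = 1 / v (complex_of_real r)\<close>, with
  \<open>b k\<close> the reciprocal of the maximum of \<open>v r * r ^ k\<close> and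
  \<open>t k\<close> a point where it is attained. Essentiality enters through \<open>cover\<close>:
  the monomials below \<open>V\<close> recover it up to the factor \<open>c\<close>.\<close>

locale tangent_monomials =
  fixes V :: "real \<Rightarrow> real" and b t :: "nat \<Rightarrow> real" and c :: real
  assumes V_mono: "\<And>r s. 0 \<le> r \<Longrightarrow> r \<le> s \<Longrightarrow> s < 1 \<Longrightarrow> V r \<le> V s"
    and V_pos: "\<And>r. 0 \<le> r \<Longrightarrow> r < 1 \<Longrightarrow> 0 < V r"
    and V_unbounded: "\<And>B. \<exists>r\<ge>0. r < 1 \<and> B < V r"
    and b_pos: "\<And>k. 0 < b k"
    and t_nonneg: "\<And>k. 0 \<le> t k" and t_less_1: "\<And>k. t k < 1"
    and touch: "\<And>k. b k * t k ^ k = V (t k)"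
    and below: "\<And>k r. 0 \<le> r \<Longrightarrow> r < 1 \<Longrightarrow> b k * r ^ k \<le> V r"
    and c_pos: "0 < c"
    and cover: "\<And>r. 0 \<le> r \<Longrightarrow> r < 1 \<Longrightarrow> \<exists>k. c * V r \<le> b k * r ^ k"
begin

section \<open>Comparison of monomials of different degree\<close>

definition tangent :: "nat \<Rightarrow> real \<Rightarrow> real" where
  "tangent k r = b k * r ^ k"

lemma tangent_nonneg: "0 \<le> r \<Longrightarrow> 0 \<le> tangent k r"
  using b_pos[of k] by (simp add: tangent_def)

lemma tangent_le: "0 \<le> r \<Longrightarrow> r < 1 \<Longrightarrow> tangent k r \<le> V r"
  using below by (simp add: tangent_def)

lemma tangent_touch: "tangent k (t k) = V (t k)"
  using touch by (simp add: tangent_def)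

text \<open>The quotient \<open>tangent l r / tangent k r\<close> is a constant times
  \<open>r ^ (l - k)\<close>, hence nondecreasing in \<open>r\<close>, so domination by the higher
  degree persists to the right. The base point is positive because values are rescaled by powers of
  \<open>y / x\<close>.\<close>

lemma tangent_dominates_up:
  assumes "k \<le> l" "0 < x" "x \<le> y" "0 \<le> \<theta>" "tangent k x \<le> \<theta> * tangent l x"
  shows "tangent k y \<le> \<theta> * tangent l y"
proof -
  have "tangent k y = tangent k x * (y / x) ^ k"
    using assms(2,3) by (simp add: tangent_def power_divide)
  also have "\<dots> \<le> (\<theta> * tangent l x) * (y / x) ^ k"
    using assms by (intro mult_right_mono) auto
  also have "\<dots> \<le> (\<theta> * tangent l x) * (y / x) ^ l"
    using assms(1-4) tangent_nonneg[of x l] by (intro mult_left_mono power_increasing) auto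
  also have "\<dots> = \<theta> * tangent l y"
    using assms(2,3) by (simp add: tangent_def power_divide)
  finally show ?thesis .
qed

text \<open>The same quotient read leftwards: domination by the lower degree persists down to
  \<open>x = 0\<close>.\<close>

lemma tangent_dominates_down:
  assumes "k \<le> l" "0 < y" "0 \<le> x" "x \<le> y" "0 \<le> \<theta>" "tangent l y \<le> \<theta> * tangent k y"
  shows "tangent l x \<le> \<theta> * tangent k x"
proof -
  have "tangent l x = tangent l y * (x / y) ^ l"
    using assms(2,3) by (simp add: tangent_def power_divide)
  also have "\<dots> \<le> (\<theta> * tangent k y) * (x / y) ^ l"
    using assms by (intro mult_right_mono) auto
  also have "\<dots> \<le> (\<theta> * tangent k y) * (x / y) ^ k"
    using assms(1-5) tangent_nonneg[of y k] by (intro mult_left_mono power_decreasing) auto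
  also have "\<dots> = \<theta> * tangent k x"
    using assms(2,3) by (simp add: tangent_def power_divide)
  finally show ?thesis .
qed

text \<open>A monomial of positive degree vanishes at 0, where \<open>V\<close> is positive, so it
  cannot touch there.\<close>

lemma t_pos: "0 < k \<Longrightarrow> 0 < t k"
  using touch[of k] V_pos[OF t_nonneg t_less_1, of k] t_nonneg[of k]
  by (cases "t k = 0") (auto simp: power_0_left)

text \<open>At \<open>t k\<close> the monomial of degree \<open>k\<close> equals \<open>V\<close>
  and is at least every other one; to the right it keeps this advantage over lower degrees.\<close>

lemma tangent_le_above:
  assumes "l \<le> k" "t k \<le> r" "r < 1"
  shows "tangent l r \<le> tangent k r"
proof (cases "l = k")
  case False
  then have "0 < t k" using assms t_pos by auto
  moreover have "tangent l (t k) \<le> 1 * tangent k (t k)"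
    using tangent_le[OF t_nonneg t_less_1] by (simp add: tangent_touch)
  ultimately show ?thesis
    using tangent_dominates_up[of l k "t k" r 1] assms by simp
qed simp

lemma tangent_le_below:
  assumes "k \<le> l" "0 \<le> r" "r \<le> t k"
  shows "tangent l r \<le> tangent k r"
proof (cases "t k = 0")
  case True
  then show ?thesis
    using tangent_le[OF t_nonneg t_less_1, of l k] assms tangent_touch[of k] by simp
next
  case False
  then have "0 < t k" using t_nonneg[of k] by simp
  moreover have "tangent l (t k) \<le> 1 * tangent k (t k)"
    using tangent_le[OF t_nonneg t_less_1] by (simp add: tangent_touch)
  ultimately show ?thesis
    using tangent_dominates_down[of k l "t k" r 1] assms by simp
qed

text \<open>If \<open>t l < t k\<close> with \<open>k < l\<close>, degree \<open>k\<close> would be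
  at least as large at the right point \<open>t k\<close> and degree \<open>l\<close> at the left
  point \<open>t l\<close>, against the strict growth of \<open>r ^ (l - k)\<close>.\<close>

lemma t_mono:
  assumes "k \<le> l"
  shows "t k \<le> t l"
proof (rule ccontr)
  assume less: "\<not> t k \<le> t l"
  then have kl: "k < l" using assms by (cases "k = l") auto
  then have tl: "0 < t l" using t_pos by simp
  have "t l ^ (l - k) < t k ^ (l - k)"
    using less tl kl by (intro power_strict_mono) auto
  then have "b l * t l ^ (l - k) < b l * t k ^ (l - k)"
    using b_pos by simp
  moreover have eq: "tangent l r = b l * r ^ (l - k) * r ^ k" for r
    using kl by (simp add: tangent_def flip: power_add)
  have "b l * t k ^ (l - k) * t k ^ k \<le> b k * t k ^ k"
    using tangent_le_below[of k l "t k"] t_nonneg[of k] assms unfolding eq by (simp add: tangent_def)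
  then have "b l * t k ^ (l - k) \<le> b k" using less tl by simp
  moreover have "b k * t l ^ k \<le> b l * t l ^ (l - k) * t l ^ k"
    using tangent_le_above[of k l "t l"] t_less_1[of l] assms unfolding eq by (simp add: tangent_def)
  then have "b k \<le> b l * t l ^ (l - k)" using tl by simp
  ultimately show False by linarith
qed

text \<open>At an intermediate \<open>s\<close> between \<open>r\<close> and 1 all monomials are
  bounded by \<open>V s\<close>; moving down to \<open>r\<close> gains the geometric factor
  \<open>(r / s) ^ k\<close>.\<close>

lemma tangent_tendsto_0:
  assumes "0 \<le> r" "r < 1"
  shows "(\<lambda>k. tangent k r) \<longlonglongrightarrow> 0"
proof -
  define s where "s = (1 + r) / 2"
  have s: "0 < s" "r < s" "s < 1" using assms by (auto simp: s_def)
  have "tangent k r \<le> V s * (r / s) ^ k" for k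
  proof -
    have "tangent k r = tangent k s * (r / s) ^ k"
      using s by (simp add: tangent_def power_divide)
    also have "\<dots> \<le> V s * (r / s) ^ k"
      using s assms by (intro mult_right_mono tangent_le zero_le_power divide_nonneg_pos) simp_all
    finally show ?thesis .
  qed
  moreover have "(\<lambda>k. V s * (r / s) ^ k) \<longlonglongrightarrow> 0"
    using s assms by (intro tendsto_mult_right_zero LIMSEQ_realpow_zero) auto
  ultimately show ?thesis
    using tangent_nonneg[OF assms(1)]
    by (intro tendsto_sandwich[of "\<lambda>_. 0" "\<lambda>k. tangent k r" _ "\<lambda>k. V s * (r / s) ^ k"]
        tendsto_const always_eventually) simp_all
qed

text \<open>A touching point at or below \<open>r\<close> would force
  \<open>tangent k (max r 0)\<close> to be at least \<open>V 0\<close>, whereas these values tend to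
  0.\<close>

lemma t_eventually_gt:
  assumes "r < 1"
  shows "\<forall>\<^sub>F k in sequentially. r < t k"
proof -
  have r: "0 \<le> max r 0" "max r 0 < 1" using assms by auto
  have "\<forall>\<^sub>F k in sequentially. tangent k (max r 0) < V 0"
    using tangent_tendsto_0[OF r] V_pos[of 0] by (intro order_tendstoD) auto
  then show ?thesis
  proof eventually_elim
    case (elim k)
    show ?case
    proof (rule ccontr)
      assume "\<not> r < t k"
      then have "t k \<le> max r 0" by simp
      then have "tangent k (t k) \<le> tangent k (max r 0)"
        using t_nonneg[of k] b_pos[of k] by (auto simp: tangent_def intro!: mult_left_mono power_mono)
      moreover have "V 0 \<le> V (t k)"
        using V_mono t_nonneg t_less_1 by simp
      ultimately show False using elim by (simp add: tangent_touch)
    qed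
  qed
qed

section \<open>Greedy choice of exponents\<close>

definition far :: "nat \<Rightarrow> nat \<Rightarrow> bool" where
  "far p q \<longleftrightarrow> (\<exists>r. t p \<le> r \<and> r \<le> t q \<and> tangent p r < c / 2 * V r \<and> tangent q r < c / 2 * V r)"

definition succ_index :: "nat \<Rightarrow> nat" where
  "succ_index p = (LEAST q. p < q \<and> far p (Suc q))"

text \<open>\<open>tangent p\<close> is at most \<open>b p\<close> and \<open>V\<close> is
  unbounded, so some \<open>r\<close> beyond \<open>t p\<close> has \<open>tangent p r\<close> too
  small. At this fixed \<open>r\<close> all monomials of large degree are small as well, and they
  touch further right.\<close>

lemma ex_far: "\<exists>q>p. far p (Suc q)"
proof -
  obtain s where s: "0 \<le> s" "s < 1" "2 * b p / c < V s"
    using V_unbounded by blast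
  define r where "r = max s (t p)"
  have r: "0 \<le> r" "r < 1" "t p \<le> r" using s t_less_1[of p] by (simp_all add: r_def)
  have "2 * b p / c < V r"
    using s V_mono[of s r] r by (auto simp: r_def)
  then have "b p < c / 2 * V r" using c_pos by (simp add: field_simps)
  moreover have "tangent p r \<le> b p * 1"
    unfolding tangent_def using r b_pos[of p] by (intro mult_left_mono power_le_one) auto
  ultimately have "tangent p r < c / 2 * V r" by simp
  moreover have "\<forall>\<^sub>F q in sequentially. tangent q r < c / 2 * V r"
    using tangent_tendsto_0[OF r(1,2)] V_pos[OF r(1,2)] c_pos by (intro order_tendstoD) auto
  then have "\<forall>\<^sub>F q in sequentially. tangent q r < c / 2 * V r \<and> r < t q \<and> Suc p < q"
    using t_eventually_gt[OF r(2)] eventually_gt_at_top[of "Suc p"] by eventually_elim auto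
  then obtain q where "tangent q r < c / 2 * V r \<and> r < t q \<and> Suc p < q"
    using eventually_happens by force
  \<comment> \<open>The bound \<open>Suc p < q\<close> leaves room to write \<open>q\<close> as a
    successor whose predecessor still exceeds \<open>p\<close>.\<close>
  ultimately have "far p (Suc (q - 1)) \<and> p < q - 1"
    unfolding far_def using r by auto
  then show ?thesis by blast
qed

lemma succ_index: "p < succ_index p" "far p (Suc (succ_index p))"
  using LeastI_ex[OF ex_far] by (auto simp: succ_index_def)

text \<open>Between adjacent touching points, degrees up to \<open>p\<close> lie below
  \<open>tangent p\<close> and all others below \<open>tangent (Suc p)\<close>. The monomial
  supplied by \<open>cover\<close> is therefore beaten by one of these two.\<close>

lemma not_far_Suc: "\<not> far p (Suc p)"
proof
  assume "far p (Suc p)"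
  then obtain r where r: "t p \<le> r" "r \<le> t (Suc p)" "tangent p r < c / 2 * V r" "tangent (Suc p) r < c / 2 * V r"
    by (auto simp: far_def)
  have r01: "0 \<le> r" "r < 1" using r t_nonneg[of p] t_less_1[of "Suc p"] by auto
  obtain k where k: "c * V r \<le> tangent k r" using cover[OF r01] by (auto simp: tangent_def)
  have "tangent k r \<le> tangent p r \<or> tangent k r \<le> tangent (Suc p) r"
    using tangent_le_above[of k p r] tangent_le_below[of "Suc p" k r] r r01 by (cases "k \<le> p") auto
  moreover have "0 < c * V r" using c_pos V_pos r01 by simp
  ultimately show False using k r by linarith
qed

text \<open>Minimality excludes \<open>far p (Suc q)\<close> for smaller \<open>q > p\<close>, which
  settles every value of \<open>succ_index p\<close> except \<open>Suc p\<close>; that one is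
  \<open>not_far_Suc\<close>.\<close>

lemma not_far_succ_index: "\<not> far p (succ_index p)"
proof (cases "succ_index p = Suc p")
  case True
  then show ?thesis using not_far_Suc by simp
next
  case False
  then have "p < succ_index p - 1" using succ_index(1)[of p] by simp
  moreover have "\<not> (p < succ_index p - 1 \<and> far p (Suc (succ_index p - 1)))"
    unfolding succ_index_def[of p]
    by (rule not_less_Least) (use succ_index(1)[of p] in \<open>auto simp: succ_index_def\<close>)
  ultimately show ?thesis using succ_index(1)[of p] by simp
qed

text \<open>Where \<open>far p (q + 1)\<close> is witnessed, some intermediate monomial \<open>tangent l\<close> with \<open>p < l \<le> q\<close> is twice
  as large as both \<open>tangent p\<close> and \<open>tangent (q + 1)\<close>; monotonicity of ratios transports this to the left and
  to the right.\<close>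

lemma separation:
  assumes "q = succ_index p" "q < q'"
  shows "\<And>r. t q' \<le> r \<Longrightarrow> r < 1 \<Longrightarrow> tangent p r \<le> tangent q r / 2"
    and "\<And>r. 0 \<le> r \<Longrightarrow> r \<le> t p \<Longrightarrow> tangent q' r \<le> tangent p r / 2"
proof -
  obtain x where x: "t p \<le> x" "x \<le> t (Suc q)" "tangent p x < c / 2 * V x" "tangent (Suc q) x < c / 2 * V x"
    using succ_index(2)[of p] assms by (auto simp: far_def)
  have x01: "0 \<le> x" "x < 1" using x t_nonneg[of p] t_less_1[of "Suc q"] by auto
  obtain l where l: "c * V x \<le> tangent l x" using cover[OF x01] by (auto simp: tangent_def)
  have cV: "0 < c * V x" using c_pos V_pos x01 by simp
  have "p < l"
  proof (rule ccontr)
    assume "\<not> p < l"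
    then show False using tangent_le_above[of l p x] x x01 l cV by simp
  qed
  have "l \<le> q"
  proof (rule ccontr)
    assume "\<not> l \<le> q"
    then show False using tangent_le_below[of "Suc q" l x] x x01 l cV by simp
  qed
  have "x \<noteq> 0" 
  proof
    assume "x = 0"
    then have "tangent l x = 0" using \<open>p < l\<close> by (simp add: tangent_def)
    then show False using l cV by simp
  qed
  then have x0: "0 < x" using x01 by simp
  have pl: "tangent p x \<le> 1/2 * tangent l x" using x(3) l by linarith
  have ql: "tangent (Suc q) x \<le> 1/2 * tangent l x" using x(4) l by linarith
  have q': "t q \<le> t q'" "t (Suc q) \<le> t q'" using assms t_mono by auto
  show "tangent p r \<le> tangent q r / 2" if r: "t q' \<le> r" "r < 1" for r
  proof -
    have "tangent p r \<le> 1/2 * tangent l r"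
      by (rule tangent_dominates_up[OF _ x0 _ _ pl]) (use \<open>p < l\<close> r x q' in auto)
    moreover have "tangent l r \<le> tangent q r"
      using tangent_le_above[of l q r] \<open>l \<le> q\<close> r q' by auto
    ultimately show ?thesis by simp
  qed
  show "tangent q' r \<le> tangent p r / 2" if r: "0 \<le> r" "r \<le> t p" for r
  proof -
    have "tangent (Suc q) r \<le> 1/2 * tangent l r"
      by (rule tangent_dominates_down[OF _ x0 _ _ _ ql]) (use \<open>l \<le> q\<close> r x in auto)
    moreover have "tangent l r \<le> tangent p r"
      using tangent_le_below[of p l r] \<open>p < l\<close> r by auto
    moreover have "tangent q' r \<le> tangent (Suc q) r"
      using tangent_le_below[of "Suc q" q' r] assms r x by auto
    ultimately show ?thesis by simp
  qed
qed

section \<open>Geometric decay along the selected exponents\<close>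

definition index :: "nat \<Rightarrow> nat" where
  "index j = (succ_index ^^ j) 0"

lemma index_Suc: "index (Suc j) = succ_index (index j)" and index_0: "index 0 = 0"
  by (simp_all add: index_def)

lemma index_strict_mono: "strict_mono index"
  by (rule strict_mono_Suc_iff[THEN iffD2]) (simp add: index_Suc succ_index)

text \<open>The selected touching points eventually pass \<open>r\<close>; the first to do so and
  its predecessor enclose it.\<close>

lemma bracket:
  assumes "0 \<le> r" "r < 1" "t (index 0) \<le> r"
  obtains j where "t (index j) \<le> r" "r \<le> t (index (Suc j))"
proof -
  have "\<forall>\<^sub>F k in sequentially. r < t (index k)"
    using t_eventually_gt[OF assms(2)] filterlim_subseq[OF index_strict_mono]
    by (rule eventually_compose_filterlim)
  then obtain k where "r < t (index k)" using eventually_happens by force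
  then obtain k where k: "r < t (index k)" "\<And>i. i < k \<Longrightarrow> \<not> r < t (index i)"
    using LeastI[of "\<lambda>k. r < t (index k)"] not_less_Least[of _ "\<lambda>k. r < t (index k)"] by blast
  have "k \<noteq> 0"
  proof
    assume "k = 0"
    then show False using k(1) assms(3) by simp
  qed
  then obtain j where "k = Suc j" by (cases k) auto
  with k have "t (index j) \<le> r" "r \<le> t (index (Suc j))" by (auto simp: not_less)
  then show ?thesis by (rule that)
qed

text \<open>\<open>separation\<close> halves the value over two selected exponents, hence the
  two-step induction. The rate \<open>3/4\<close> works because its square exceeds
  \<open>1/2\<close>, and the prefactor 2 covers the first step, for which only monotonicity is
  available.\<close>

lemma future_decay:
  assumes "0 \<le> r" "r \<le> t (index j)"
  shows "tangent (index (j + i)) r \<le> 2 * (3/4) ^ i * tangent (index j) r"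
proof -
  have nn: "0 \<le> tangent (index j) r" using assms tangent_nonneg by simp
  show ?thesis
  proof (induction i rule: induct_nat_012)
    case 0
    then show ?case using nn by simp
  next
    case 1
    have "tangent (index (Suc j)) r \<le> tangent (index j) r"
      using tangent_le_below[of "index j" "index (Suc j)" r] assms index_strict_mono
      by (simp add: strict_mono_less_eq)
    then show ?case using nn by simp
  next
    case (ge2 i)
    have "t (index j) \<le> t (index (j + i))"
      using index_strict_mono by (intro t_mono) (simp add: strict_mono_less_eq)
    then have "tangent (index (Suc (Suc (j + i)))) r \<le> tangent (index (j + i)) r / 2"
      using assms index_strict_mono
      by (intro separation(2)[of "index (Suc (j + i))"]) (auto simp: index_Suc succ_index)
    also have "\<dots> \<le> (2 * (3/4) ^ i * tangent (index j) r) / 2"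
      using ge2.IH(1) by simp
    also have "\<dots> \<le> 2 * (3/4) ^ (Suc (Suc i)) * tangent (index j) r"
      using nn by (simp add: mult_right_mono)
    finally show ?case by simp
  qed
qed

text \<open>\<open>separation\<close> halves the value at each step back except the first one from
  \<open>index j\<close>, because the exponent \<open>q'\<close> in it must touch at or before
  \<open>r\<close>. The two leading monomials are just bounded by \<open>V r\<close>, which costs
  the prefactor 2.\<close>

lemma past_decay:
  assumes "t (index j) \<le> r" "r < 1" "i \<le> j"
  shows "tangent (index (j - i)) r \<le> 2 * (1/2) ^ i * V r"
proof -
  have r: "0 \<le> r" using assms t_nonneg order_trans by blast
  show ?thesis using assms(3)
  proof (induction i rule: induct_nat_012)
    case 0
    then show ?case using tangent_le[OF r assms(2), of "index j"] V_pos[OF r assms(2)] by simp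
  next
    case 1
    then show ?case using tangent_le[OF r assms(2)] by simp
  next
    case (ge2 i)
    define k where "k = j - Suc (Suc i)"
    have k: "j - Suc i = Suc k" "Suc (Suc k) \<le> j" using ge2.prems by (auto simp: k_def)
    have "t (index (Suc (Suc k))) \<le> t (index j)"
      using index_strict_mono k by (intro t_mono) (simp add: strict_mono_less_eq)
    then have "tangent (index k) r \<le> tangent (index (Suc k)) r / 2"
      using assms by (intro separation(1)[of _ _ "index (Suc (Suc k))"]) (auto simp: index_Suc succ_index)
    then show ?case using ge2.IH(2) ge2.prems k by (simp add: k_def[symmetric])
  qed
qed

text \<open>For \<open>r\<close> between consecutive selected touching points, the exponents up to
  the left one contribute at most \<open>2 * (2 * V r)\<close> and the later ones at most
  \<open>4 * (2 * V r)\<close>, by the geometric series of ratios \<open>1/2\<close> and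
  \<open>3/4\<close>.\<close>

lemma partial_sum_le:
  assumes "0 \<le> r" "r < 1"
  shows "(\<Sum>i<N. tangent (index i) r) \<le> 12 * V r"
proof -
  have V: "0 < V r" using V_pos assms by simp
  have future: "(\<Sum>i<N. tangent (index (j + i)) r) \<le> 8 * V r" if "r \<le> t (index j)" for j N
  proof -
    have "(\<Sum>i<N. tangent (index (j + i)) r) \<le> (\<Sum>i<N. (3/4) ^ i * (2 * V r))"
    proof (rule sum_mono)
      fix i
      have "tangent (index (j + i)) r \<le> 2 * (3/4) ^ i * tangent (index j) r"
        using future_decay assms that by simp
      also have "\<dots> \<le> 2 * (3/4) ^ i * V r"
        using tangent_le[OF assms] by (intro mult_left_mono) auto
      finally show "tangent (index (j + i)) r \<le> (3/4) ^ i * (2 * V r)" by (simp add: mult_ac)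
    qed
    also have "\<dots> = (\<Sum>i<N. (3/4) ^ i) * (2 * V r)" by (rule sum_distrib_right[symmetric])
    also have "\<dots> \<le> 4 * (2 * V r)"
      using V by (intro mult_right_mono) (simp_all add: sum_gp_strict del: power_divide)
    finally show ?thesis by simp
  qed
  show ?thesis
  proof (cases "r \<le> t (index 0)")
    case True
    then show ?thesis using future[of 0 N] V by simp
  next
    case False
    then obtain j where j: "t (index j) \<le> r" "r \<le> t (index (Suc j))"
      using bracket[OF assms] by force
    have past: "(\<Sum>i<Suc j. tangent (index i) r) \<le> 4 * V r"
    proof -
      have "(\<Sum>i<Suc j. tangent (index i) r) = (\<Sum>i<Suc j. tangent (index (j - i)) r)"
        by (rule sum.reindex_bij_witness[of _ "\<lambda>i. j - i" "\<lambda>i. j - i"]) auto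
      also have "\<dots> \<le> (\<Sum>i<Suc j. (1/2) ^ i * (2 * V r))"
        by (rule sum_mono) (use past_decay[OF j(1) assms(2)] in \<open>auto simp: mult_ac\<close>)
      also have "\<dots> = (\<Sum>i<Suc j. (1/2) ^ i) * (2 * V r)" by (rule sum_distrib_right[symmetric])
      also have "\<dots> \<le> 2 * (2 * V r)"
        using V by (intro mult_right_mono) (simp_all add: sum_gp_strict del: power_divide sum.lessThan_Suc)
      finally show ?thesis by simp
    qed
    have "(\<Sum>i<N. tangent (index i) r) \<le> (\<Sum>i<Suc j + N. tangent (index i) r)"
      using tangent_nonneg[OF assms(1)] by (intro sum_mono2) auto
    also have "\<dots> = (\<Sum>i<Suc j. tangent (index i) r) + (\<Sum>i<N. tangent (index (Suc j + i)) r)"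
      by (induction N) auto
    also have "\<dots> \<le> 12 * V r" using past future[OF j(2), of N] by simp
    finally show ?thesis .
  qed
qed

lemma summable_tangent: "0 \<le> r \<Longrightarrow> r < 1 \<Longrightarrow> summable (\<lambda>i. tangent (index i) r)"
  using summableI_nonneg_bounded[of "\<lambda>i. tangent (index i) r" "12 * V r"] tangent_nonneg partial_sum_le by blast

lemma sum_tangent_le: "0 \<le> r \<Longrightarrow> r < 1 \<Longrightarrow> (\<Sum>i. tangent (index i) r) \<le> 12 * V r"
  using suminf_le_const[of "\<lambda>i. tangent (index i) r" "12 * V r"] summable_tangent partial_sum_le by blast

text \<open>A single summand suffices: up to the first touching point the constant monomial already
  reaches \<open>V\<close>, and between consecutive ones \<open>not_far_succ_index\<close> keeps a
  neighbour above \<open>c / 2 * V r\<close>.\<close>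

lemma sum_tangent_ge:
  assumes "0 \<le> r" "r < 1"
  shows "min 1 (c / 2) * V r \<le> (\<Sum>i. tangent (index i) r)"
proof -
  have V: "0 < V r" using V_pos assms by simp
  have summand: "tangent (index j) r \<le> (\<Sum>i. tangent (index i) r)" for j
    using sum_le_suminf[OF summable_tangent[OF assms], of "{j}"] tangent_nonneg[OF assms(1)] by simp
  have "\<exists>j. min 1 (c / 2) * V r \<le> tangent (index j) r"
  proof (cases "r \<le> t (index 0)")
    case True
    then have "V r \<le> tangent (index 0) r"
      using V_mono[of r "t 0"] touch[of 0] t_less_1[of 0] assms by (simp add: tangent_def index_0)
    moreover have "min 1 (c / 2) * V r \<le> 1 * V r"
      using V by (intro mult_right_mono) auto
    ultimately show ?thesis by (intro exI[of _ 0]) simp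
  next
    case False
    then obtain j where j: "t (index j) \<le> r" "r \<le> t (index (Suc j))"
      using bracket[OF assms] by force
    have "c / 2 * V r \<le> tangent (index j) r \<or> c / 2 * V r \<le> tangent (index (Suc j)) r"
      using not_far_succ_index[of "index j"] j unfolding far_def index_Suc by (auto simp: not_less)
    moreover have "min 1 (c / 2) * V r \<le> c / 2 * V r"
      using V by (intro mult_right_mono) auto
    ultimately show ?thesis using order_trans by blast
  qed
  then show ?thesis using summand order_trans by blast
qed

end

section \<open>Weights and test functions\<close>

lemma weight_pos: "is_weight v \<Longrightarrow> cmod z < 1 \<Longrightarrow> 0 < v z"
  unfolding is_weight_def by (metis mem_ball_0)

lemma weight_radial: "is_weight v \<Longrightarrow> cmod z < 1 \<Longrightarrow> v z = v (complex_of_real (cmod z))"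
  unfolding is_weight_def by (metis mem_ball_0)

lemma weight_antimono:
  "is_weight v \<Longrightarrow> cmod z \<le> cmod z' \<Longrightarrow> cmod z' < 1 \<Longrightarrow> v z' \<le> v z"
  unfolding is_weight_def by (meson mem_ball_0 le_less_trans)

lemma weight_continuous: "is_weight v \<Longrightarrow> continuous_on (ball 0 1) v"
  unfolding is_weight_def by blast

lemma weight_tendsto_0: "is_weight v \<Longrightarrow> ((\<lambda>r. v (complex_of_real r)) \<longlongrightarrow> 0) (at_left 1)"
  unfolding is_weight_def by blast

lemma weight_continuous_real:
  assumes "is_weight v"
  shows "continuous_on {0..<1} (\<lambda>r. v (complex_of_real r))"
  by (rule continuous_on_compose2[OF weight_continuous[OF assms]]) (auto intro!: continuous_intros)

lemma Hinf_holomorphic: "f \<in> Hinf v \<Longrightarrow> f holomorphic_on ball 0 1"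
  by (simp add: Hinf_def)

lemma HinfI:
  "f holomorphic_on ball 0 1 \<Longrightarrow> (\<And>z. cmod z < 1 \<Longrightarrow> v z * cmod (f z) \<le> C) \<Longrightarrow> f \<in> Hinf v"
  unfolding Hinf_def mem_Collect_eq by (metis mem_ball_0)

text \<open>Membership in \<open>Hinf v\<close> supplies the boundedness without which the real
  supremum in \<open>wnorm\<close> carries no information.\<close>

lemma wnorm_upper:
  assumes "f \<in> Hinf v" "cmod z < 1"
  shows "v z * cmod (f z) \<le> wnorm v f"
  unfolding wnorm_def by (rule cSUP_upper) (use assms in \<open>auto simp: Hinf_def bdd_above_def\<close>)

lemma wnorm_le: "(\<And>z. cmod z < 1 \<Longrightarrow> v z * cmod (f z) \<le> C) \<Longrightarrow> wnorm v f \<le> C"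
  unfolding wnorm_def by (rule cSUP_least) auto

lemma Hinf_bound:
  assumes "is_weight v" "f \<in> Hinf v" "cmod z < 1"
  shows "cmod (f z) \<le> wnorm v f / v z"
  using wnorm_upper[OF assms(2,3)] weight_pos[OF assms(1,3)] by (simp add: field_simps)

lemma wnorm_nonneg:
  assumes "is_weight v" "f \<in> Hinf v"
  shows "0 \<le> wnorm v f"
proof -
  have "0 \<le> v 0 * cmod (f 0)" using weight_pos[OF assms(1), of 0] by simp
  also have "\<dots> \<le> wnorm v f" using assms(2) by (rule wnorm_upper) simp
  finally show ?thesis .
qed

lemma Hinf_lincomb:
  assumes "is_weight v" "f \<in> Hinf v" "g \<in> Hinf v"
  shows "(\<lambda>z. a * f z + b * g z) \<in> Hinf v"
proof (rule HinfI)
  show "(\<lambda>z. a * f z + b * g z) holomorphic_on ball 0 1"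
    using assms by (intro holomorphic_intros Hinf_holomorphic)
  fix z :: complex assume z: "cmod z < 1"
  have "v z * cmod (a * f z + b * g z) \<le> v z * (cmod a * cmod (f z) + cmod b * cmod (g z))"
    using weight_pos[OF assms(1) z] norm_triangle_ineq[of "a * f z" "b * g z"]
    by (intro mult_left_mono) (auto simp: norm_mult)
  also have "\<dots> = cmod a * (v z * cmod (f z)) + cmod b * (v z * cmod (g z))"
    by (simp add: algebra_simps)
  also have "\<dots> \<le> cmod a * wnorm v f + cmod b * wnorm v g"
    using wnorm_upper[OF assms(2) z] wnorm_upper[OF assms(3) z]
    by (intro add_mono mult_left_mono) auto
  finally show "v z * cmod (a * f z + b * g z) \<le> cmod a * wnorm v f + cmod b * wnorm v g" .
qed

lemma Hinf_diff:
  "is_weight v \<Longrightarrow> f \<in> Hinf v \<Longrightarrow> g \<in> Hinf v \<Longrightarrow> (\<lambda>z. f z - g z) \<in> Hinf v"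
  using Hinf_lincomb[of v f g 1 "-1"] by simp

lemma wnorm_triangle:
  assumes "is_weight w" "(\<lambda>z. f z - g z) \<in> Hinf w" "g \<in> Hinf w"
  shows "wnorm w f \<le> wnorm w (\<lambda>z. f z - g z) + wnorm w g"
proof (rule wnorm_le)
  fix z :: complex assume z: "cmod z < 1"
  have "w z * cmod (f z) \<le> w z * (cmod (f z - g z) + cmod (g z))"
    using weight_pos[OF assms(1) z] norm_triangle_ineq[of "f z - g z" "g z"]
    by (intro mult_left_mono) auto
  then show "w z * cmod (f z) \<le> wnorm w (\<lambda>z. f z - g z) + wnorm w g"
    using wnorm_upper[OF assms(2) z] wnorm_upper[OF assms(3) z] by (simp add: algebra_simps)
qed

lemma bounded_holomorphic_in_Hinf:
  assumes "is_weight v" "f holomorphic_on ball 0 1" "\<And>z. cmod z < 1 \<Longrightarrow> cmod (f z) \<le> B"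
  shows "f \<in> Hinf v"
proof (rule HinfI[OF assms(2)])
  fix z :: complex assume z: "cmod z < 1"
  show "v z * cmod (f z) \<le> v 0 * B"
    using weight_antimono[OF assms(1), of 0 z] assms(3)[OF z] weight_pos[OF assms(1), of 0] z
    by (intro mult_mono) auto
qed

text \<open>A variant of the three circles theorem: the maximum principle for
  \<open>f z / z ^ k\<close> on an annulus bounds every \<open>f\<close> of the unit ball at
  \<open>r\<close> by the values of \<open>1 / v\<close> on the two circles. Essentiality passes
  this bound on to \<open>1 / v\<close> at \<open>r\<close>.\<close>

lemma essential_weight_annulus:
  assumes v: "is_weight v" and ess: "essential_weight v"
  obtains c where "0 < c" "c \<le> 1"
    "\<And>a r b k. 0 < a \<Longrightarrow> a < r \<Longrightarrow> r < b \<Longrightarrow> b < 1 \<Longrightarrow>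
      c / v (complex_of_real r) \<le>
      r ^ k * max (1 / v (complex_of_real a) / a ^ k) (1 / v (complex_of_real b) / b ^ k)"
proof -
  let ?U = "{f \<in> Hinf v. wnorm v f \<le> 1}"
  obtain c where c: "c > 0"
    "\<And>z. cmod z < 1 \<Longrightarrow> c / v z \<le> (SUP f\<in>?U. cmod (f z))"
    "\<And>z. cmod z < 1 \<Longrightarrow> (SUP f\<in>?U. cmod (f z)) \<le> 1 / v z"
    using ess by (auto simp: essential_weight_def)
  \<comment> \<open>Comparing both essentiality bounds at the origin gives \<open>c \<le> 1\<close>,
    which later makes exponent 0 a valid start of the search.\<close>
  have "c / v 0 \<le> 1 / v 0" using c(2)[of 0] c(3)[of 0] by simp
  then have c1: "c \<le> 1" using weight_pos[OF v, of 0] by (simp add: divide_le_cancel)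
  have ne: "(\<lambda>_. 0) \<in> ?U"
    using bounded_holomorphic_in_Hinf[OF v, of "\<lambda>_. 0" 0] by (auto intro!: wnorm_le)
  have annulus: "c / v (complex_of_real r) \<le>
      r ^ k * max (1 / v (complex_of_real a) / a ^ k) (1 / v (complex_of_real b) / b ^ k)"
    (is "_ \<le> _ * ?M")
    if ab: "0 < a" "a < r" "r < b" "b < 1" for a r b :: real and k
  proof -
    have "cmod (f (complex_of_real r)) \<le> r ^ k * ?M" if "f \<in> ?U" for f
    proof -
      have f: "f \<in> Hinf v" "wnorm v f \<le> 1" using that by auto
      let ?S = "cball 0 b - ball 0 a :: complex set"
      have fb: "cmod (f z) \<le> 1 / v (complex_of_real (cmod z))" if z: "cmod z < 1" for z
      proof -
        have "cmod (f z) \<le> wnorm v f / v z" by (rule Hinf_bound[OF v f(1) z])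
        also have "\<dots> \<le> 1 / v z" using weight_pos[OF v z] f(2) by (intro divide_right_mono) auto
        finally show ?thesis using weight_radial[OF v z] by simp
      qed
      have hol: "(\<lambda>z. f z / z ^ k) holomorphic_on ball 0 1 - {0}"
        by (intro holomorphic_intros holomorphic_on_subset[OF Hinf_holomorphic[OF f(1)]]) auto
      have "cmod (f (complex_of_real r) / complex_of_real r ^ k) \<le> ?M"
      proof (rule maximum_modulus_frontier[of "\<lambda>z. f z / z ^ k" ?S])
        show "(\<lambda>z. f z / z ^ k) holomorphic_on interior ?S"
          by (rule holomorphic_on_subset[OF hol]) (use ab interior_subset[of ?S] in auto)
        have "closed ?S" by (intro closed_Diff) auto
        then show "continuous_on (closure ?S) (\<lambda>z. f z / z ^ k)"
          using ab by (intro holomorphic_on_imp_continuous_on holomorphic_on_subset[OF hol]) auto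
        show "bounded ?S" by (intro bounded_diff) auto
        show "complex_of_real r \<in> ?S" using ab by auto
        fix z assume "z \<in> frontier ?S"
        then have "z \<in> frontier (cball 0 b) \<union> frontier (- ball 0 a)"
          using frontier_Int_subset[of "cball 0 b" "- ball 0 a"] by (auto simp: Diff_eq)
        then have z: "cmod z = b \<or> cmod z = a"
          using ab by (auto simp: frontier_complement)
        then have "cmod z < 1" using ab by auto
        then have "cmod (f z / z ^ k) \<le> 1 / v (complex_of_real (cmod z)) / cmod z ^ k"
          unfolding norm_divide norm_power by (intro divide_right_mono fb) simp_all
        then show "cmod (f z / z ^ k) \<le> ?M" using z by auto
      qed
      then show ?thesis using ab by (simp add: norm_divide norm_power field_simps)
    qed
    then have "(SUP f\<in>?U. cmod (f (complex_of_real r))) \<le> r ^ k * ?M"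
      using ne by (intro cSUP_least) auto
    then show ?thesis using c(2)[of "complex_of_real r"] ab by simp
  qed
  show ?thesis using that[OF c(1) c1 annulus] by blast
qed

text \<open>The exponent \<open>k\<close> is an integer slope of an approximate supporting line for
  the logarithm of \<open>1 / v\<close> as a function of the logarithm of the radius. Multiplying
  out \<open>r ^ k\<close> lets the statement include \<open>r = 0\<close>.\<close>

lemma essential_weight_monomial:
  assumes v: "is_weight v" and ess: "essential_weight v"
  obtains c where "0 < c"
    "\<And>r. 0 \<le> r \<Longrightarrow> r < 1 \<Longrightarrow> \<exists>k. \<forall>s. 0 \<le> s \<and> s < 1 \<longrightarrow>
      c / v (complex_of_real r) * s ^ k \<le> 1 / v (complex_of_real s) * r ^ k"
proof -
  define V where "V r = 1 / v (complex_of_real r)" for r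
  obtain c where c: "0 < c" "c \<le> 1" and annulus:
    "\<And>a r b k. 0 < a \<Longrightarrow> a < r \<Longrightarrow> r < b \<Longrightarrow> b < 1 \<Longrightarrow> c / v (complex_of_real r) \<le> r ^ k * max (V a / a ^ k) (V b / b ^ k)"
    using essential_weight_annulus[OF v ess] unfolding V_def by blast
  have cV: "c / v (complex_of_real r) = c * V r" for c r by (simp add: V_def)
  have V_pos: "0 < V r" if "0 \<le> r" "r < 1" for r
    using weight_pos[OF v, of "complex_of_real r"] that by (simp add: V_def)
  have V_mono: "V r \<le> V s" if "0 \<le> r" "r \<le> s" "s < 1" for r s
    unfolding V_def using that weight_pos[OF v, of "complex_of_real s"]
    by (intro divide_left_mono weight_antimono[OF v] mult_pos_pos weight_pos[OF v]) auto
  \<comment> \<open>The factor \<open>c / 2\<close> pays for lowering the exponent on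
    \<open>[1/2, r]\<close>. The quotient \<open>V 0 / V (1/2)\<close> pays for the points
    \<open>s\<close> below \<open>1/2\<close> and makes exponent 0 work when
    \<open>r \<le> 1/2\<close>.\<close>
  define d where "d = c / 2 * V 0 / V (1/2)"
  have V0: "0 < V 0" "V 0 \<le> V (1/2)" "0 < V (1/2)" using V_pos V_mono by auto
  have d: "0 < d" "d \<le> c / 2"
    using c V0 by (auto simp: d_def field_simps)
  have dV: "d * V (1/2) = c / 2 * V 0" using V0 by (simp add: d_def)
  have "\<exists>k. \<forall>s. 0 \<le> s \<and> s < 1 \<longrightarrow> d * V r * s ^ k \<le> V s * r ^ k" if r: "0 \<le> r" "r < 1" for r
  proof (cases "r \<le> 1/2")
    case True
    have "d * V r * s ^ 0 \<le> V s * r ^ 0" if s: "0 \<le> s" "s < 1" for s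
    proof -
      have "d * V r \<le> d * V (1/2)" using True V_mono r d by (intro mult_left_mono) auto
      also have "\<dots> \<le> 1 * V 0" unfolding dV using c V0 by (intro mult_right_mono) auto
      also have "\<dots> \<le> V s" using V_mono s by simp
      finally show ?thesis by simp
    qed
    then show ?thesis by blast
  next
    case False
    \<comment> \<open>Of the last exponent \<open>k\<close> satisfying the bound to the right of \<open>r\<close>, the exponent \<open>k + 1\<close> satisfies the
      one to the left by \<open>annulus\<close>; lowering it to \<open>k\<close> costs a factor \<open>2\<close> on \<open>[1/2, r]\<close>.\<close>
    define P where "P k \<longleftrightarrow> (\<forall>b. r < b \<and> b < 1 \<longrightarrow> c * V r \<le> r ^ k * (V b / b ^ k))" for k
    have Vr: "0 < V r" using V_pos r by simp
    have P0: "P 0"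
    proof -
      have "c * V r \<le> V b" if "r < b" "b < 1" for b
        using mult_right_mono[OF c(2), of "V r"] Vr V_mono[of r b] that r by linarith
      then show ?thesis by (simp add: P_def)
    qed
    \<comment> \<open>At a fixed radius \<open>b\<close> beyond \<open>r\<close> the factor
      \<open>(r / b) ^ k\<close> tends to 0, so large exponents violate the bound.\<close>
    have "\<exists>k. \<not> P k"
    proof -
      define b where "b = (1 + r) / 2"
      have b: "r < b" "b < 1" "0 < b" using r by (auto simp: b_def)
      have "(\<lambda>k. V b * (r / b) ^ k) \<longlonglongrightarrow> 0"
        using b r by (intro tendsto_mult_right_zero LIMSEQ_realpow_zero) auto
      then have "\<forall>\<^sub>F k in sequentially. V b * (r / b) ^ k < c * V r"
        using c Vr by (intro order_tendstoD) auto
      then obtain k where "V b * (r / b) ^ k < c * V r"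
        using eventually_happens by force
      then have "\<not> P k" unfolding P_def using b
        by (auto simp: power_divide not_le intro!: exI[of _ b]) (simp add: mult_ac)
      then show ?thesis ..
    qed
    then obtain k where k: "P k" "\<not> P (Suc k)"
      using P0 nat_induct[of P] by blast
    obtain b where b: "r < b" "b < 1" "r ^ Suc k * (V b / b ^ Suc k) < c * V r"
      using k(2) unfolding P_def not_all not_imp not_le by blast
    \<comment> \<open>The outer circle of radius \<open>b\<close> gives less than
      \<open>c * V r\<close> for exponent \<open>k + 1\<close>, so the maximum in
      \<open>annulus\<close> comes from the inner circle, whatever \<open>a\<close> is.\<close>
    have left: "c * V r \<le> r ^ Suc k * (V a / a ^ Suc k)" if a: "0 < a" "a < r" for a
      using annulus[OF a b(1,2), of "Suc k"] b(3) unfolding cV by (auto simp: max_def split: if_splits)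
    have right: "d * V r * s ^ k \<le> V s * r ^ k" if s: "1/2 \<le> s" "s < 1" for s
    proof -
      have "c / 2 * V r * s ^ k \<le> V s * r ^ k"
      proof (cases s r rule: linorder_cases)
        case less
        have "c * V r * s ^ Suc k \<le> r ^ Suc k * V s"
          using left[of s] less s by (simp add: field_simps)
        also have "\<dots> \<le> V s * r ^ k" 
          using r V_pos[of s] s by (simp add: mult_ac mult_left_le_one_le)
        finally have "c * V r * s ^ k * s \<le> V s * r ^ k" by (simp add: mult_ac)
        moreover have "c * V r * s ^ k * (1/2) \<le> c * V r * s ^ k * s"
          using s c Vr by (intro mult_left_mono) auto
        ultimately show ?thesis by simp
      next
        case equal
        then show ?thesis using c Vr s by (auto intro!: mult_right_mono)
      next
        case greater
        have "c * V r * s ^ k \<le> V s * r ^ k"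
          using k(1) greater s False by (auto simp: P_def field_simps)
        moreover have "c / 2 * V r * s ^ k \<le> c * V r * s ^ k"
          using s c Vr by (intro mult_right_mono) auto
        ultimately show ?thesis by linarith
      qed
      moreover have "d * V r * s ^ k \<le> c / 2 * V r * s ^ k"
        using d Vr s by (intro mult_right_mono) auto
      ultimately show ?thesis by linarith
    qed
    have "d * V r * s ^ k \<le> V s * r ^ k" if s: "0 \<le> s" "s < 1" for s
    proof (cases "1/2 \<le> s")
      case True
      then show ?thesis using right s by simp
    next
      case False': False
      \<comment> \<open>For small \<open>s\<close> lowering the exponent would cost the unbounded
        factor \<open>1 / s\<close>. The bound is taken at \<open>1/2\<close> instead and carried to
        \<open>s\<close> by monotonicity, using \<open>V 0 \<le> V s\<close>.\<close>
      have half: "c / 2 * V r * (1/2) ^ k \<le> V (1/2) * r ^ k"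
      proof -
        have "c * V r * (1/2) ^ Suc k \<le> r ^ Suc k * V (1/2)"
          using left[of "1/2"] False by (simp add: field_simps)
        also have "\<dots> \<le> V (1/2) * r ^ k"
          using r V_pos[of "1/2"] by (simp add: mult_ac mult_left_le_one_le)
        finally show ?thesis by simp
      qed
      have "d * V r * s ^ k \<le> d * V r * (1/2) ^ k"
        using False' s d Vr by (intro mult_left_mono power_mono) auto
      also have "\<dots> = V 0 / V (1/2) * (c / 2 * V r * (1/2) ^ k)" by (simp add: d_def mult_ac)
      also have "\<dots> \<le> V 0 / V (1/2) * (V (1/2) * r ^ k)"
        using half V0 by (intro mult_left_mono) auto
      also have "\<dots> = V 0 * r ^ k" using V0 by simp
      also have "\<dots> \<le> V s * r ^ k" using V_mono s r by (intro mult_right_mono) auto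
      finally show ?thesis .
    qed
    then show ?thesis by blast
  qed
  then show ?thesis using that[OF d(1)] unfolding V_def by simp
qed

text \<open>Since \<open>v\<close> tends to 0 at the boundary, the product extended by 0 at 1 is
  continuous on \<open>[0, 1]\<close>. Its value at \<open>1/2\<close> is positive, so the maximum
  is not attained at 1.\<close>

lemma weight_times_power_attains_max:
  assumes v: "is_weight v"
  obtains t where "0 \<le> t" "t < 1" "0 < v (complex_of_real t) * t ^ k"
    "\<And>r. 0 \<le> r \<Longrightarrow> r < 1 \<Longrightarrow> v (complex_of_real r) * r ^ k \<le> v (complex_of_real t) * t ^ k"
proof -
  define h where "h r = (if r < 1 then v (complex_of_real r) * r ^ k else 0)" for r :: real
  have "continuous (at r within {0..1}) h" if r: "r \<in> {0..1}" for r
  proof (cases "r = 1")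
    case True
    have "((\<lambda>r. v (complex_of_real r) * r ^ k) \<longlongrightarrow> 0 * 1 ^ k) (at_left 1)"
      by (intro tendsto_intros weight_tendsto_0[OF v])
    then have "((\<lambda>r. v (complex_of_real r) * r ^ k) \<longlongrightarrow> h 1) (at_left 1)"
      by (simp add: h_def)
    then have "(h \<longlongrightarrow> h 1) (at_left 1)"
      by (rule Lim_transform_eventually) (auto simp: h_def eventually_at_filter)
    then have "(h \<longlongrightarrow> h 1) (at 1 within {0..1})"
      by (simp add: at_within_Icc_at_left)
    then show ?thesis using True by (simp add: continuous_within)
  next
    case False
    have "continuous_on {0..<1} (\<lambda>r. v (complex_of_real r) * r ^ k)"
      by (intro continuous_intros weight_continuous_real[OF v])
    then have "continuous_on {0..<1} h"
      by (rule continuous_on_eq) (simp add: h_def)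
    then have "continuous (at r within {0..<1}) h"
      using False r by (auto simp: continuous_on_eq_continuous_within)
    moreover have "at r within {0..<1} = at r within {0..1}"
      by (rule at_within_nhd[of r "{..<1}"]) (use False r in auto)
    ultimately show ?thesis by simp
  qed
  then have "continuous_on {0..1} h" by (simp add: continuous_on_eq_continuous_within)
  then obtain t where t: "t \<in> {0..1}" "\<And>r. r \<in> {0..1} \<Longrightarrow> h r \<le> h t"
    using continuous_attains_sup[of "{0..1::real}" h] by auto
  have "0 < h (1/2)"
    using weight_pos[OF v, of "complex_of_real (1/2)"] by (simp add: h_def)
  also have "\<dots> \<le> h t" using t(2)[of "1/2"] by simp
  finally have ht: "0 < h t" .
  then have t1: "t < 1" by (simp add: h_def split: if_splits)
  have "v (complex_of_real r) * r ^ k \<le> v (complex_of_real t) * t ^ k" if "0 \<le> r" "r < 1" for r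
    using t(2)[of r] that t1 by (simp add: h_def)
  then show ?thesis using that[of t] t(1) t1 ht by (simp add: h_def)
qed

text \<open>The function is the lacunary power series with coefficients \<open>b (index i)\<close>.
  As these are positive, it is real on \<open>[0, 1)\<close> and its modulus at \<open>z\<close> is
  at most its value at \<open>cmod z\<close>, so the estimates on the radius control the whole
  disc.\<close>

lemma essential_weight_test_function:
  assumes v: "is_weight v" and ess: "essential_weight v"
  obtains f g c where "f \<in> Hinf v" "0 < c"
    "\<And>r. 0 \<le> r \<Longrightarrow> r < 1 \<Longrightarrow> f (complex_of_real r) = complex_of_real (g r)"
    "\<And>r. 0 \<le> r \<Longrightarrow> r < 1 \<Longrightarrow> c / v (complex_of_real r) \<le> g r"
proof -
  define V where "V r = 1 / v (complex_of_real r)" for r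
  have v_pos: "0 < v (complex_of_real r)" if "0 \<le> r" "r < 1" for r
    using weight_pos[OF v, of "complex_of_real r"] that by simp
  have "\<exists>t. 0 \<le> t \<and> t < 1 \<and> 0 < v (complex_of_real t) * t ^ k \<and>
    (\<forall>r. 0 \<le> r \<and> r < 1 \<longrightarrow> v (complex_of_real r) * r ^ k \<le> v (complex_of_real t) * t ^ k)" for k
    using weight_times_power_attains_max[OF v, of k] by metis
  then obtain t where t: "\<And>k. 0 \<le> t k" "\<And>k. t k < 1" "\<And>k. 0 < v (complex_of_real (t k)) * t k ^ k"
    "\<And>k r. 0 \<le> r \<Longrightarrow> r < 1 \<Longrightarrow> v (complex_of_real r) * r ^ k \<le> v (complex_of_real (t k)) * t k ^ k"
    by metis
  \<comment> \<open>This is the largest coefficient for which the monomial of degree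
    \<open>k\<close> stays below \<open>V\<close>; equality occurs at \<open>t k\<close>.\<close>
  define b where "b k = 1 / (v (complex_of_real (t k)) * t k ^ k)" for k
  obtain c where c: "0 < c"
    "\<And>r. 0 \<le> r \<Longrightarrow> r < 1 \<Longrightarrow> \<exists>k. \<forall>s. 0 \<le> s \<and> s < 1 \<longrightarrow>
      c / v (complex_of_real r) * s ^ k \<le> 1 / v (complex_of_real s) * r ^ k"
    using essential_weight_monomial[OF v ess] by metis
  interpret tangent_monomials V b t c
  proof
    show "V r \<le> V s" if "0 \<le> r" "r \<le> s" "s < 1" for r s
      unfolding V_def using that v_pos
      by (intro divide_left_mono weight_antimono[OF v] mult_pos_pos) auto
    show "0 < V r" if "0 \<le> r" "r < 1" for r using v_pos[OF that] by (simp add: V_def)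
    show "\<exists>r\<ge>0. r < 1 \<and> B < V r" for B
    proof -
      have "\<forall>\<^sub>F r in at_left 1. v (complex_of_real r) < 1 / (\<bar>B\<bar> + 1)"
        using weight_tendsto_0[OF v] by (rule order_tendstoD) (simp add: add_nonneg_pos)
      moreover have "\<forall>\<^sub>F r in at_left (1::real). 0 < r \<and> r < 1"
        using eventually_at_left_real[of 0 "1::real"] by simp
      ultimately have "\<forall>\<^sub>F r in at_left (1::real). 0 < r \<and> r < 1 \<and> v (complex_of_real r) < 1 / (\<bar>B\<bar> + 1)"
        by eventually_elim auto
      then obtain r where r: "0 < r" "r < 1" "v (complex_of_real r) < 1 / (\<bar>B\<bar> + 1)"
        using eventually_happens[of _ "at_left (1::real)"] trivial_limit_at_left_real by blast
      then have "\<bar>B\<bar> + 1 < V r"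
        using v_pos[of r] by (simp add: V_def field_simps)
      then show ?thesis using r by (intro exI[of _ r]) auto
    qed
    show "0 < b k" for k using t(3)[of k] by (simp add: b_def)
    show "0 \<le> t k" "t k < 1" for k using t by auto
    show "b k * t k ^ k = V (t k)" for k
    proof -
      have "t k ^ k \<noteq> 0" using t(3)[of k] by (metis mult_zero_right less_irrefl)
      then show ?thesis by (simp add: b_def V_def)
    qed
    show "b k * r ^ k \<le> V r" if "0 \<le> r" "r < 1" for k r
      using t(4)[OF that, of k] t(3)[of k] v_pos[OF that]
      by (simp add: b_def V_def divide_simps mult_ac)
    show "0 < c" by fact
    show "\<exists>k. c * V r \<le> b k * r ^ k" if r: "0 \<le> r" "r < 1" for r
    proof -
      obtain k where k: "\<And>s. 0 \<le> s \<Longrightarrow> s < 1 \<Longrightarrow>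
          c / v (complex_of_real r) * s ^ k \<le> 1 / v (complex_of_real s) * r ^ k"
        using c(2)[OF r] by blast
      \<comment> \<open>The supporting inequality is evaluated at \<open>s = t k\<close>, where
        \<open>V\<close> equals \<open>b k * s ^ k\<close>; cancelling \<open>t k ^ k\<close> leaves
        the claim at \<open>r\<close>.\<close>
      have tk: "0 < t k ^ k" using t(1,3)[of k] by (simp add: zero_less_mult_iff)
      then have "t k ^ k \<noteq> 0" by (rule less_imp_neq[symmetric])
      then have "b k * t k ^ k = 1 / v (complex_of_real (t k))" by (simp add: b_def)
      then have "b k * r ^ k * t k ^ k = 1 / v (complex_of_real (t k)) * r ^ k"
        by (metis mult.assoc mult.commute)
      then have "c * V r * t k ^ k \<le> b k * r ^ k * t k ^ k"
        using k[OF t(1,2)[of k]] by (simp add: V_def)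
      then show ?thesis using tk by auto
    qed
  qed
  define f where "f z = (\<Sum>i. complex_of_real (b (index i)) * z ^ index i)" for z
  define g where "g r = (\<Sum>i. tangent (index i) r)" for r
  have norm_eq: "cmod (complex_of_real (b (index i)) * z ^ index i) = tangent (index i) (cmod z)" for i z
    using b_pos[of "index i"] by (simp add: tangent_def norm_mult norm_power)
  have "f holomorphic_on ball 0 1"
  proof (rule holomorphic_uniform_sequence[where f = "\<lambda>n z. \<Sum>i<n. complex_of_real (b (index i)) * z ^ index i"])
    show "open (ball 0 1 :: complex set)" by simp
    show "(\<lambda>z. \<Sum>i<n. complex_of_real (b (index i)) * z ^ index i) holomorphic_on ball 0 1" for n
      by (intro holomorphic_intros)
    fix x :: complex assume x: "x \<in> ball 0 1"
    \<comment> \<open>The closed disc of radius \<open>d\<close> about \<open>x\<close> stays within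
      radius \<open>cmod x + d < 1\<close>, and the monomials at that radius are summable
      majorants.\<close>
    define d where "d = (1 - cmod x) / 2"
    have d: "0 < d" "cmod x + d < 1" using x by (auto simp: d_def field_simps)
    have le: "cmod z \<le> cmod x + d" if "z \<in> cball x d" for z
      using that norm_triangle_ineq2[of z x] by (simp add: dist_norm norm_minus_commute)
    have "uniform_limit (cball x d) (\<lambda>n z. \<Sum>i<n. complex_of_real (b (index i)) * z ^ index i) f sequentially"
      unfolding f_def
    proof (rule Weierstrass_m_test)
      show "summable (\<lambda>i. tangent (index i) (cmod x + d))"
        using d by (intro summable_tangent) auto
      show "cmod (complex_of_real (b (index i)) * z ^ index i) \<le> tangent (index i) (cmod x + d)" if "z \<in> cball x d" for i z
        unfolding norm_eq unfolding tangent_def using le[OF that] b_pos[of "index i"]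
        by (intro mult_left_mono power_mono) auto
    qed
    moreover have "cball x d \<subseteq> ball 0 1" using le d by force
    ultimately show "\<exists>d>0. cball x d \<subseteq> ball 0 1 \<and>
        uniform_limit (cball x d) (\<lambda>n z. \<Sum>i<n. complex_of_real (b (index i)) * z ^ index i) f sequentially"
      using d(1) by blast
  qed
  moreover have "v z * cmod (f z) \<le> 12" if z: "cmod z < 1" for z
  proof -
    have "cmod (f z) \<le> (\<Sum>i. tangent (index i) (cmod z))"
      unfolding f_def norm_eq[symmetric]
      by (rule summable_norm) (use summable_tangent[of "cmod z"] z in \<open>simp add: norm_eq\<close>)
    also have "\<dots> \<le> 12 * V (cmod z)" using sum_tangent_le[of "cmod z"] z by simp
    also have "\<dots> = 12 / v z" using weight_radial[OF v z] by (simp add: V_def)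
    finally show ?thesis using weight_pos[OF v z] by (simp add: field_simps)
  qed
  ultimately have "f \<in> Hinf v" by (rule HinfI)
  moreover have "0 < min 1 (c / 2)" using c by simp
  moreover have "f (complex_of_real r) = complex_of_real (g r)" if "0 \<le> r" "r < 1" for r
    unfolding f_def g_def using suminf_of_real[OF summable_tangent[OF that], where ?'a = complex]
    by (simp add: tangent_def)
  moreover have "min 1 (c / 2) / v (complex_of_real r) \<le> g r" if "0 \<le> r" "r < 1" for r
    using sum_tangent_ge[OF that] by (simp add: V_def g_def)
  ultimately show ?thesis by (rule that)
qed

section \<open>The operator\<close>

lemma kernel_bounds:
  assumes "0 \<le> t" "t < 1" "cmod z \<le> r" "r < 1"
  shows "1 - r \<le> 1 - t * r" "1 - t * r \<le> cmod (1 - complex_of_real t * z)"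
    "1 - complex_of_real t * z \<noteq> 0"
proof -
  have r: "0 \<le> r" using assms norm_ge_zero order_trans by blast
  then have "t * r \<le> 1 * r" using assms by (intro mult_right_mono) auto
  then show *: "1 - r \<le> 1 - t * r" by simp
  have "1 - t * r \<le> 1 - cmod (complex_of_real t * z)"
    using assms by (simp add: norm_mult mult_left_mono)
  also have "\<dots> \<le> cmod (1 - complex_of_real t * z)"
    using norm_triangle_ineq2[of 1 "complex_of_real t * z"] by simp
  finally show **: "1 - t * r \<le> cmod (1 - complex_of_real t * z)" .
  then show "1 - complex_of_real t * z \<noteq> 0" using * assms by auto
qed

locale Imu_setting = finite_measure mu for mu :: "real measure" +
  fixes v w :: "complex \<Rightarrow> real"
  assumes sets_mu: "sets mu = sets (restrict_space borel {0..<1::real})"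
    and v: "is_weight v" and w: "is_weight w"
    and integrable_inverse_weight: "integrable mu (\<lambda>t. 1 / v (complex_of_real t))"
begin

lemma space_mu: "space mu = {0..<1}"
  using sets_eq_imp_space_eq[OF sets_mu] by (simp add: space_restrict_space)

lemma v_pos: "0 \<le> t \<Longrightarrow> t < 1 \<Longrightarrow> 0 < v (complex_of_real t)"
  by (rule weight_pos[OF v]) simp

lemma measurable_mu:
  fixes f :: "real \<Rightarrow> 'a::topological_space"
  shows "continuous_on {0..<1} f \<Longrightarrow> f \<in> borel_measurable mu"
  by (subst measurable_cong_sets[OF sets_mu refl]) (rule borel_measurable_continuous_on_restrict)

lemma continuous_on_of_real:
  assumes "f holomorphic_on ball 0 1"
  shows "continuous_on {0..<1} (\<lambda>t. f (complex_of_real t))"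
  by (rule continuous_on_compose2[OF holomorphic_on_imp_continuous_on[OF assms]])
    (auto intro!: continuous_intros)

lemma continuous_on_kernel:
  assumes "f holomorphic_on ball 0 1" "cmod z < 1"
  shows "continuous_on {0..<1} (\<lambda>t. f (complex_of_real t) / (1 - complex_of_real t * z))"
  by (intro continuous_intros continuous_on_of_real assms)
    (use kernel_bounds(3)[OF _ _ order_refl assms(2)] in auto)

text \<open>The integrability claims for the kernel reduce to domination by a multiple of
  \<open>1 / v\<close>; continuity on \<open>[0, 1)\<close> takes care of measurability.\<close>

lemma integrable_dominated:
  fixes g :: "real \<Rightarrow> 'a::{banach, second_countable_topology}"
  assumes "continuous_on {0..<1} g"
    and "\<And>t. 0 \<le> t \<Longrightarrow> t < 1 \<Longrightarrow> norm (g t) \<le> B / v (complex_of_real t)"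
  shows "integrable mu g"
proof (rule Bochner_Integration.integrable_bound)
  show "integrable mu (\<lambda>t. B * (1 / v (complex_of_real t)))"
    by (intro integrable_mult_right integrable_inverse_weight)
  show "g \<in> borel_measurable mu" by (rule measurable_mu) fact
  show "AE t in mu. norm (g t) \<le> norm (B * (1 / v (complex_of_real t)))"
  proof (rule AE_I2)
    fix t assume "t \<in> space mu"
    then have "norm (g t) \<le> B / v (complex_of_real t)" using assms(2) by (simp add: space_mu)
    then show "norm (g t) \<le> norm (B * (1 / v (complex_of_real t)))"
      by (simp only: real_norm_def mult_1_right times_divide_eq_right order_trans[OF _ abs_ge_self])
  qed
qed

section \<open>Pointwise estimates and holomorphy of the integral operator\<close>

definition K :: "real \<Rightarrow> real" where
  "K r = (LINT t|mu. 1 / (v (complex_of_real t) * (1 - t * r)))"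

text \<open>The first bound keeps the dependence of the kernel on \<open>t\<close> and leads to
  \<open>K\<close>, for use near the boundary. The second replaces the kernel by
  \<open>1 / (1 - r)\<close>, for use on smaller discs.\<close>

lemma kernel_le:
  assumes "0 \<le> t" "t < 1" "cmod z \<le> r" "r < 1" "norm a \<le> B / v (complex_of_real t)"
  shows "norm (a / (1 - complex_of_real t * z)) \<le> B / (v (complex_of_real t) * (1 - t * r))"
    and "norm (a / (1 - complex_of_real t * z)) \<le> norm a / (1 - r)"
proof -
  note k = kernel_bounds[OF assms(1-4)]
  have "norm (a / (1 - complex_of_real t * z)) \<le> norm a / (1 - t * r)"
    unfolding norm_divide using k assms(4) by (intro divide_left_mono mult_pos_pos) auto
  also have "\<dots> \<le> B / v (complex_of_real t) / (1 - t * r)"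
    using assms k by (intro divide_right_mono) auto
  finally show "norm (a / (1 - complex_of_real t * z)) \<le> B / (v (complex_of_real t) * (1 - t * r))"
    by simp
  show "norm (a / (1 - complex_of_real t * z)) \<le> norm a / (1 - r)"
    unfolding norm_divide using k assms(4) by (intro divide_left_mono mult_pos_pos) auto
qed

lemma integrable_K:
  assumes "0 \<le> r" "r < 1"
  shows "integrable mu (\<lambda>t. 1 / (v (complex_of_real t) * (1 - t * r)))"
proof (rule integrable_dominated[where B = "1 / (1 - r)"])
  have k: "1 - r \<le> 1 - t * r" if "0 \<le> t" "t < 1" for t
    using kernel_bounds(1)[of t "complex_of_real r" r] that assms by simp
  show "continuous_on {0..<1} (\<lambda>t. 1 / (v (complex_of_real t) * (1 - t * r)))"
    using k v_pos assms
    by (intro continuous_intros weight_continuous_real[OF v]) (force simp: less_le_not_le)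
  fix t :: real assume t: "0 \<le> t" "t < 1"
  show "norm (1 / (v (complex_of_real t) * (1 - t * r))) \<le> 1 / (1 - r) / v (complex_of_real t)"
  proof -
    have "v (complex_of_real t) * (1 - r) \<le> v (complex_of_real t) * (1 - t * r)"
      using k[OF t] v_pos[OF t] by (intro mult_left_mono) auto
    moreover have "0 < v (complex_of_real t) * (1 - r)" using v_pos[OF t] assms by simp
    ultimately have "1 / (v (complex_of_real t) * (1 - t * r)) \<le> 1 / (v (complex_of_real t) * (1 - r))"
      by (intro frac_le zero_le_one order_refl)
    moreover have "0 \<le> 1 / (v (complex_of_real t) * (1 - t * r))"
      using k[OF t] v_pos[OF t] assms by (intro divide_nonneg_nonneg mult_nonneg_nonneg) auto
    ultimately show ?thesis by (simp add: mult_ac)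
  qed
qed

lemma integrable_Imu:
  assumes "f \<in> Hinf v" "cmod z < 1"
  shows "integrable mu (\<lambda>t. f (complex_of_real t) / (1 - complex_of_real t * z))"
proof (rule integrable_dominated[where B = "wnorm v f / (1 - cmod z)"])
  show "continuous_on {0..<1} (\<lambda>t. f (complex_of_real t) / (1 - complex_of_real t * z))"
    by (rule continuous_on_kernel[OF Hinf_holomorphic[OF assms(1)] assms(2)])
  fix t :: real assume t: "0 \<le> t" "t < 1"
  have "cmod (f (complex_of_real t)) \<le> wnorm v f / v (complex_of_real t)"
    using Hinf_bound[OF v assms(1)] t by simp
  then have "cmod (f (complex_of_real t)) / (1 - cmod z) \<le> wnorm v f / v (complex_of_real t) / (1 - cmod z)"
    using assms by (intro divide_right_mono) auto
  then show "cmod (f (complex_of_real t) / (1 - complex_of_real t * z))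
      \<le> wnorm v f / (1 - cmod z) / v (complex_of_real t)"
    using kernel_le(2)[OF t order_refl assms(2), of "f (complex_of_real t)"]
      \<open>cmod (f (complex_of_real t)) \<le> wnorm v f / v (complex_of_real t)\<close>
    by (force simp: mult.commute)
qed

lemma Imu_le_K:
  assumes "f \<in> Hinf v" "cmod z < 1"
  shows "cmod (Imu mu f z) \<le> wnorm v f * K (cmod z)"
proof -
  have "cmod (Imu mu f z) \<le> (LINT t|mu. cmod (f (complex_of_real t) / (1 - complex_of_real t * z)))"
    unfolding Imu_def by (rule integral_norm_bound)
  also have "\<dots> \<le> (LINT t|mu. wnorm v f * (1 / (v (complex_of_real t) * (1 - t * cmod z))))"
  proof (rule integral_mono)
    fix t assume "t \<in> space mu"
    then have t: "0 \<le> t" "t < 1" by (auto simp: space_mu)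
    show "cmod (f (complex_of_real t) / (1 - complex_of_real t * z)) \<le>
        wnorm v f * (1 / (v (complex_of_real t) * (1 - t * cmod z)))"
      using kernel_le(1)[OF t order_refl assms(2) Hinf_bound[OF v assms(1)]] t by simp
  next
    show "integrable mu (\<lambda>t. cmod (f (complex_of_real t) / (1 - complex_of_real t * z)))"
      by (intro integrable_norm integrable_Imu assms)
    show "integrable mu (\<lambda>t. wnorm v f * (1 / (v (complex_of_real t) * (1 - t * cmod z))))"
      using assms by (intro integrable_mult_right integrable_K) auto
  qed
  also have "\<dots> = wnorm v f * K (cmod z)"
    unfolding K_def by (rule integral_mult_right_zero)
  finally show ?thesis .
qed

text \<open>On a disc of radius \<open>r < 1\<close> the kernel is bounded, so convergence in L1 of
  the functions gives uniform convergence of their images there.\<close>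

lemma Imu_le_L1:
  assumes "f \<in> Hinf v" "cmod z \<le> r" "r < 1"
  shows "cmod (Imu mu f z) \<le> (LINT t|mu. cmod (f (complex_of_real t))) / (1 - r)"
proof -
  have z: "cmod z < 1" using assms by simp
  have fi: "integrable mu (\<lambda>t. f (complex_of_real t))"
    using integrable_Imu[OF assms(1), of 0] by simp
  have "cmod (Imu mu f z) \<le> (LINT t|mu. cmod (f (complex_of_real t) / (1 - complex_of_real t * z)))"
    unfolding Imu_def by (rule integral_norm_bound)
  also have "\<dots> \<le> (LINT t|mu. cmod (f (complex_of_real t)) / (1 - r))"
  proof (rule integral_mono)
    fix t assume "t \<in> space mu"
    then have t: "0 \<le> t" "t < 1" by (auto simp: space_mu)
    show "cmod (f (complex_of_real t) / (1 - complex_of_real t * z)) \<le> cmod (f (complex_of_real t)) / (1 - r)"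
      using kernel_le(2)[OF t assms(2,3) Hinf_bound[OF v assms(1)]] t by simp
  qed (use integrable_Imu[OF assms(1) z] fi in auto)
  finally show ?thesis by simp
qed

lemma Imu_diff:
  assumes "f \<in> Hinf v" "g \<in> Hinf v" "cmod z < 1"
  shows "Imu mu (\<lambda>z. f z - g z) z = Imu mu f z - Imu mu g z"
  unfolding Imu_def
  using Bochner_Integration.integral_diff[OF integrable_Imu[OF assms(1,3)] integrable_Imu[OF assms(2,3)]]
  by (simp add: diff_divide_distrib)

lemma Imu_scale: "Imu mu (\<lambda>z. a * f z) z = a * Imu mu f z"
  unfolding Imu_def by (simp flip: times_divide_eq_right)

text \<open>Differentiation under the integral sign: the difference quotient of the kernel between
  \<open>x\<close> and \<open>y\<close> is \<open>t / ((1 - t * y) * (1 - t * x))\<close>, of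
  modulus at most \<open>1 / (1 - s) ^ 2\<close> when both points lie in the disc of radius
  \<open>s\<close>.\<close>

lemma Imu_holomorphic:
  assumes f: "f \<in> Hinf v"
  shows "Imu mu f holomorphic_on ball 0 1"
proof -
  have "\<exists>D. (Imu mu f has_field_derivative D) (at x)" if x: "x \<in> ball 0 1" for x
  proof -
    define s where "s = (1 + cmod x) / 2"
    have s: "cmod x < s" "s < 1" using x by (auto simp: s_def)
    define D where "D = (LINT t|mu. f (complex_of_real t) * complex_of_real t /
      ((1 - complex_of_real t * x) * (1 - complex_of_real t * x)))"
    have "((\<lambda>y. (Imu mu f y - Imu mu f x) / (y - x)) \<longlongrightarrow> D) (at x within ball 0 s)"
      \<comment> \<open>Dominated convergence works along sequences, so the limit is tested on
        sequences tending to \<open>x\<close>.\<close>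
      unfolding tendsto_at_iff_sequentially
    proof (intro allI impI)
      fix X assume X: "\<forall>i. X i \<in> ball 0 s - {x}" "X \<longlonglongrightarrow> x"
      define q where "q i t = f (complex_of_real t) * complex_of_real t /
        ((1 - complex_of_real t * X i) * (1 - complex_of_real t * x))" for i t
      have Xs: "cmod (X i) < s" "X i \<noteq> x" for i using X(1) by auto
      have "(Imu mu f (X i) - Imu mu f x) / (X i - x) = integral\<^sup>L mu (q i)" for i
      proof -
        have X1: "cmod (X i) < 1" "cmod x < 1" using Xs[of i] s by auto
        have "(Imu mu f (X i) - Imu mu f x) / (X i - x) =
          (LINT t|mu. (f (complex_of_real t) / (1 - complex_of_real t * X i)
            - f (complex_of_real t) / (1 - complex_of_real t * x)) / (X i - x))"
          unfolding Imu_def using integrable_Imu[OF f X1(1)] integrable_Imu[OF f X1(2)] by simp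
        also have "\<dots> = integral\<^sup>L mu (q i)"
        proof (rule Bochner_Integration.integral_cong[OF refl])
          fix t assume "t \<in> space mu"
          then have t: "0 \<le> t" "t < 1" by (auto simp: space_mu)
          have nz: "1 - complex_of_real t * X i \<noteq> 0" "1 - complex_of_real t * x \<noteq> 0" "X i - x \<noteq> 0"
            using kernel_bounds(3)[OF t order_refl] X1 Xs(2)[of i] by auto
          then have "f (complex_of_real t) / (1 - complex_of_real t * X i)
            - f (complex_of_real t) / (1 - complex_of_real t * x) = (X i - x) * q i t"
            unfolding q_def by (simp add: diff_frac_eq algebra_simps)
          then show "(f (complex_of_real t) / (1 - complex_of_real t * X i)
            - f (complex_of_real t) / (1 - complex_of_real t * x)) / (X i - x) = q i t"
            using nz by simp
        qed
        finally show ?thesis .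
      qed
      moreover have "(\<lambda>i. integral\<^sup>L mu (q i)) \<longlonglongrightarrow> D"
        unfolding D_def
      proof (rule integral_dominated_convergence[where w = "\<lambda>t. wnorm v f / (1 - s) / (1 - s) * (1 / v (complex_of_real t))"])
        have cont: "continuous_on {0..<1} (\<lambda>t. f (complex_of_real t) * complex_of_real t /
            ((1 - complex_of_real t * y) * (1 - complex_of_real t * x)))" if "cmod y < 1" for y
        proof (intro continuous_intros continuous_on_of_real Hinf_holomorphic[OF f])
          show "\<forall>t\<in>{0..<1}. (1 - complex_of_real t * y) * (1 - complex_of_real t * x) \<noteq> 0"
            using kernel_bounds(3)[OF _ _ order_refl that] kernel_bounds(3)[OF _ _ order_refl, of _ x] s by auto
        qed
        show "(\<lambda>t. f (complex_of_real t) * complex_of_real t /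
            ((1 - complex_of_real t * x) * (1 - complex_of_real t * x))) \<in> borel_measurable mu"
          using cont s by (intro measurable_mu) auto
        show "q i \<in> borel_measurable mu" for i
          unfolding q_def using cont[of "X i"] Xs[of i] s by (intro measurable_mu) auto
        show "integrable mu (\<lambda>t. wnorm v f / (1 - s) / (1 - s) * (1 / v (complex_of_real t)))"
          by (intro integrable_mult_right integrable_inverse_weight)
        show "AE t in mu. (\<lambda>i. q i t) \<longlonglongrightarrow> f (complex_of_real t) * complex_of_real t /
            ((1 - complex_of_real t * x) * (1 - complex_of_real t * x))"
        proof (rule AE_I2)
          fix t assume "t \<in> space mu"
          then have "1 - complex_of_real t * x \<noteq> 0"
            using kernel_bounds(3)[OF _ _ order_refl, of t x] s by (auto simp: space_mu)
          then show "(\<lambda>i. q i t) \<longlonglongrightarrow> f (complex_of_real t) * complex_of_real t /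
            ((1 - complex_of_real t * x) * (1 - complex_of_real t * x))"
            unfolding q_def by (intro tendsto_intros X(2)) auto
        qed
        show "AE t in mu. norm (q i t) \<le> wnorm v f / (1 - s) / (1 - s) * (1 / v (complex_of_real t))" for i
        proof (rule AE_I2)
          fix t assume "t \<in> space mu"
          then have t: "0 \<le> t" "t < 1" by (auto simp: space_mu)
          let ?a = "f (complex_of_real t) / (1 - complex_of_real t * x)"
          have fb: "cmod (f (complex_of_real t)) \<le> wnorm v f / v (complex_of_real t)"
            using Hinf_bound[OF v f] t by simp
          have "cmod (q i t) = cmod (?a / (1 - complex_of_real t * X i)) * t"
            using t by (simp add: q_def norm_divide norm_mult mult_ac)
          also have "\<dots> \<le> cmod (?a / (1 - complex_of_real t * X i)) * 1"
            using t by (intro mult_left_mono) auto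
          also have "\<dots> \<le> cmod ?a / (1 - s)"
            using kernel_le(2)[OF t, of "X i" s ?a "cmod ?a * v (complex_of_real t)"] Xs[of i] s v_pos[OF t] by simp
          also have "\<dots> \<le> cmod (f (complex_of_real t)) / (1 - s) / (1 - s)"
            using kernel_le(2)[OF t _ _ fb, of x s] s by (intro divide_right_mono) auto
          also have "\<dots> \<le> wnorm v f / v (complex_of_real t) / (1 - s) / (1 - s)"
            using fb s by (intro divide_right_mono) auto
          finally show "norm (q i t) \<le> wnorm v f / (1 - s) / (1 - s) * (1 / v (complex_of_real t))"
            by (simp add: mult_ac)
        qed
      qed
      ultimately show "((\<lambda>y. (Imu mu f y - Imu mu f x) / (y - x)) \<circ> X) \<longlonglongrightarrow> D"
        by (simp add: o_def)
    qed
    then have "(Imu mu f has_field_derivative D) (at x within ball 0 s)"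
      by (simp add: has_field_derivative_iff)
    then have "(Imu mu f has_field_derivative D) (at x)"
      using s by (simp add: at_within_open[of x "ball 0 s"])
    then show ?thesis ..
  qed
  then show ?thesis
    by (simp add: holomorphic_on_open)
qed

end

section \<open>Membership in \<open>H0\<close>\<close>

lemma H0_subset_Hinf: "H0 w \<subseteq> Hinf w"
  by (auto simp: H0_def)

lemma H0D:
  assumes "f \<in> H0 w" "0 < e"
  obtains r where "0 \<le> r" "r < 1" "\<And>z. r < cmod z \<Longrightarrow> cmod z < 1 \<Longrightarrow> w z * cmod (f z) < e"
proof -
  obtain r where r: "r < 1" "\<And>z. r < cmod z \<and> cmod z < 1 \<longrightarrow> w z * cmod (f z) < e"
    using assms unfolding H0_def by blast
  then show ?thesis using that[of "max r 0"] by auto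
qed

text \<open>Decay at the boundary already implies the weighted bound: the case \<open>e = 1\<close>
  handles an outer annulus, and continuity handles the remaining compact disc.\<close>

lemma H0I:
  assumes w: "is_weight w" and hol: "f holomorphic_on ball 0 1"
    and decay: "\<And>e. 0 < e \<Longrightarrow> \<exists>r<1. \<forall>z. r < cmod z \<and> cmod z < 1 \<longrightarrow> w z * cmod (f z) < e"
  shows "f \<in> H0 w"
proof -
  obtain r where r: "r < 1" "\<And>z. r < cmod z \<Longrightarrow> cmod z < 1 \<Longrightarrow> w z * cmod (f z) < 1"
    using decay[of 1] by auto
  have sub: "cball 0 r \<subseteq> (ball 0 1 :: complex set)" using r by auto
  have "continuous_on (cball 0 r) (\<lambda>z. w z * cmod (f z))"
    by (intro continuous_intros continuous_on_subset[OF weight_continuous[OF w] sub]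
        continuous_on_subset[OF holomorphic_on_imp_continuous_on[OF hol] sub])
  then have "bdd_above ((\<lambda>z. w z * cmod (f z)) ` cball 0 r)"
    by (intro bounded_imp_bdd_above compact_imp_bounded compact_continuous_image) auto
  then obtain B where B: "\<forall>z\<in>cball 0 r. w z * cmod (f z) \<le> B"
    unfolding bdd_above_def by (auto simp del: mem_cball_0)
  have "f \<in> Hinf w"
  proof (rule HinfI[OF hol])
    fix z :: complex assume z: "cmod z < 1"
    show "w z * cmod (f z) \<le> max B 1"
      using bspec[OF B, of z] r(2)[OF _ z] by (cases "cmod z \<le> r") auto
  qed
  then show ?thesis unfolding H0_def using decay by blast
qed

lemma H0_scale:
  assumes w: "is_weight w" and f: "f \<in> H0 w"
  shows "(\<lambda>z. a * f z) \<in> H0 w"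
proof (rule H0I[OF w])
  show "(\<lambda>z. a * f z) holomorphic_on ball 0 1"
    using f H0_subset_Hinf by (intro holomorphic_intros Hinf_holomorphic) auto
  fix e :: real assume e: "0 < e"
  \<comment> \<open>The summand 1 covers \<open>a = 0\<close> and makes the final estimate
    strict.\<close>
  define d where "d = e / (cmod a + 1)"
  have d: "0 < d" using e by (simp add: d_def add_nonneg_pos)
  obtain r where r: "r < 1" "\<And>z. r < cmod z \<Longrightarrow> cmod z < 1 \<Longrightarrow> w z * cmod (f z) < d"
    using H0D[OF f d] by metis
  have "w z * cmod (a * f z) < e" if z: "r < cmod z" "cmod z < 1" for z
  proof -
    have "w z * cmod (a * f z) = cmod a * (w z * cmod (f z))" by (simp add: norm_mult)
    also have "\<dots> \<le> cmod a * d" using r(2)[OF z] by (intro mult_left_mono) auto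
    also have "\<dots> < (cmod a + 1) * d" using d by (intro mult_strict_right_mono) auto
    also have "\<dots> = e" using add_nonneg_pos[OF norm_ge_zero[of a] zero_less_one] by (simp add: d_def)
    finally show ?thesis .
  qed
  then show "\<exists>r<1. \<forall>z. r < cmod z \<and> cmod z < 1 \<longrightarrow> w z * cmod (a * f z) < e"
    using r(1) by blast
qed

text \<open>One approximant within \<open>e / 2\<close> of \<open>g\<close> in norm hands its own
  decay over to \<open>g\<close>.\<close>

lemma H0_closed:
  assumes w: "is_weight w" and g: "g \<in> Hinf w" and G: "\<And>n. G n \<in> H0 w"
    and lim: "(\<lambda>n. wnorm w (\<lambda>z. G n z - g z)) \<longlonglongrightarrow> 0"
  shows "g \<in> H0 w"
proof (rule H0I[OF w Hinf_holomorphic[OF g]])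
  fix e :: real assume e: "0 < e"
  have "\<forall>\<^sub>F n in sequentially. wnorm w (\<lambda>z. G n z - g z) < e / 2"
    using e by (intro order_tendstoD(2)[OF lim]) auto
  then obtain n where n: "wnorm w (\<lambda>z. G n z - g z) < e / 2"
    using eventually_happens by force
  have Gn: "G n \<in> Hinf w" using G H0_subset_Hinf by auto
  obtain r where r: "r < 1" "\<And>z. r < cmod z \<Longrightarrow> cmod z < 1 \<Longrightarrow> w z * cmod (G n z) < e / 2"
    using H0D[OF G half_gt_zero[OF e]] by metis
  have "w z * cmod (g z) < e" if z: "r < cmod z" "cmod z < 1" for z
  proof -
    have "w z * cmod (g z) \<le> w z * (cmod (G n z) + cmod (G n z - g z))"
      using weight_pos[OF w z(2)] norm_triangle_ineq4[of "G n z" "G n z - g z"]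
      by (intro mult_left_mono) auto
    also have "\<dots> = w z * cmod (G n z) + w z * cmod (G n z - g z)" by (simp add: distrib_left)
    finally show ?thesis
      using r(2)[OF z] wnorm_upper[OF Hinf_diff[OF w Gn g] z(2)] n by linarith
  qed
  then show "\<exists>r<1. \<forall>z. r < cmod z \<and> cmod z < 1 \<longrightarrow> w z * cmod (g z) < e"
    using r(1) by blast
qed

section \<open>Compactness of the operator and its consequences\<close>

context Imu_setting
begin

lemma const_in_Hinf: "(\<lambda>_. a) \<in> Hinf v"
  by (rule bounded_holomorphic_in_Hinf[OF v, of _ "cmod a"]) auto

text \<open>Dominated convergence with the majorant \<open>(1 + wnorm v f) / v\<close> turns
  pointwise convergence of a norm bounded sequence into convergence in L1.\<close>

lemma L1_convergence:
  assumes F: "\<And>n. F n \<in> Hinf v" "\<And>n. wnorm v (F n) \<le> 1" and f: "f \<in> Hinf v"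
    and lim: "\<And>z. cmod z < 1 \<Longrightarrow> (\<lambda>n. F n z) \<longlonglongrightarrow> f z"
  shows "(\<lambda>n. LINT t|mu. cmod (F n (complex_of_real t) - f (complex_of_real t))) \<longlonglongrightarrow> 0"
proof -
  have "(\<lambda>n. LINT t|mu. cmod (F n (complex_of_real t) - f (complex_of_real t))) \<longlonglongrightarrow> (LINT t|mu. 0)"
  proof (rule integral_dominated_convergence[where w = "\<lambda>t. (1 + wnorm v f) * (1 / v (complex_of_real t))"])
    show "(\<lambda>t. cmod (F n (complex_of_real t) - f (complex_of_real t))) \<in> borel_measurable mu" for n
      by (intro measurable_mu continuous_intros continuous_on_of_real Hinf_holomorphic[OF F(1)]
          Hinf_holomorphic[OF f])
    show "integrable mu (\<lambda>t. (1 + wnorm v f) * (1 / v (complex_of_real t)))"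
      by (intro integrable_mult_right integrable_inverse_weight)
    show "AE t in mu. (\<lambda>n. cmod (F n (complex_of_real t) - f (complex_of_real t))) \<longlonglongrightarrow> 0"
    proof (rule AE_I2)
      fix t assume "t \<in> space mu"
      then have "(\<lambda>n. F n (complex_of_real t)) \<longlonglongrightarrow> f (complex_of_real t)"
        by (intro lim) (auto simp: space_mu)
      then show "(\<lambda>n. cmod (F n (complex_of_real t) - f (complex_of_real t))) \<longlonglongrightarrow> 0"
        using LIM_zero tendsto_norm_zero by blast
    qed
    show "AE t in mu. norm (cmod (F n (complex_of_real t) - f (complex_of_real t)))
        \<le> (1 + wnorm v f) * (1 / v (complex_of_real t))" for n
    proof (rule AE_I2)
      fix t assume "t \<in> space mu"
      then have t: "0 \<le> t" "t < 1" by (auto simp: space_mu)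
      have "cmod (F n (complex_of_real t)) \<le> wnorm v (F n) / v (complex_of_real t)"
        using Hinf_bound[OF v F(1)] t by simp
      also have "\<dots> \<le> 1 / v (complex_of_real t)"
        using F(2) v_pos[OF t] by (intro divide_right_mono) auto
      finally have "cmod (F n (complex_of_real t)) \<le> 1 / v (complex_of_real t)" .
      moreover have "cmod (f (complex_of_real t)) \<le> wnorm v f / v (complex_of_real t)"
        using Hinf_bound[OF v f] t by simp
      ultimately show "norm (cmod (F n (complex_of_real t) - f (complex_of_real t)))
        \<le> (1 + wnorm v f) * (1 / v (complex_of_real t))"
        using norm_triangle_ineq4[of "F n (complex_of_real t)" "f (complex_of_real t)"]
        by (simp add: add_divide_distrib)
    qed
  qed simp
  then show ?thesis by simp
qed

lemma Imu_diff_le_L1: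
  assumes "f \<in> Hinf v" "g \<in> Hinf v" "cmod z \<le> r" "r < 1"
  shows "cmod (Imu mu f z - Imu mu g z) \<le>
    (LINT t|mu. cmod (f (complex_of_real t) - g (complex_of_real t))) / (1 - r)"
  using Imu_le_L1[OF Hinf_diff[OF v assms(1,2)] assms(3,4)] Imu_diff[OF assms(1,2), of z] assms(3,4)
  by simp

text \<open>Radiality of \<open>w\<close> turns the one-sided limit along the radius into a bound on
  an annulus.\<close>

lemma kernel_decay:
  assumes "((\<lambda>r. w (complex_of_real r) * K r) \<longlongrightarrow> 0) (at_left 1)" "0 < e"
  obtains r where "0 \<le> r" "r < 1"
    "\<And>z. r < cmod z \<Longrightarrow> cmod z < 1 \<Longrightarrow> w z * K (cmod z) < e"
proof -
  have "\<forall>\<^sub>F r in at_left 1. w (complex_of_real r) * K r < e"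
    by (rule order_tendstoD(2)[OF assms])
  then obtain r where r: "r < 1" "\<And>s. r < s \<Longrightarrow> s < 1 \<Longrightarrow> w (complex_of_real s) * K s < e"
    by (auto simp: eventually_at_left_field)
  show ?thesis
  proof (rule that[of "max r 0"])
    fix z assume z: "max r 0 < cmod z" "cmod z < 1"
    show "w z * K (cmod z) < e"
      using r(2)[of "cmod z"] z weight_radial[OF w z(2)] by simp
  qed (use r in auto)
qed

lemma weighted_Imu_le:
  assumes "f \<in> Hinf v" "cmod z < 1"
  shows "w z * cmod (Imu mu f z) \<le> wnorm v f * (w z * K (cmod z))"
proof -
  have "w z * cmod (Imu mu f z) \<le> w z * (wnorm v f * K (cmod z))"
    using Imu_le_K[OF assms] weight_pos[OF w assms(2)] by (intro mult_left_mono) auto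
  then show ?thesis by (simp add: mult_ac)
qed

lemma Imu_in_H0_of_kernel_decay:
  assumes C1: "((\<lambda>r. w (complex_of_real r) * K r) \<longlongrightarrow> 0) (at_left 1)" and f: "f \<in> Hinf v"
  shows "Imu mu f \<in> H0 w"
proof (rule H0I[OF w Imu_holomorphic[OF f]])
  fix e :: real assume e: "0 < e"
  define d where "d = e / (wnorm v f + 1)"
  have N: "0 \<le> wnorm v f" by (rule wnorm_nonneg[OF v f])
  have d: "0 < d" using e N by (simp add: d_def)
  obtain r where r: "r < 1" "\<And>z. r < cmod z \<Longrightarrow> cmod z < 1 \<Longrightarrow> w z * K (cmod z) < d"
    using kernel_decay[OF C1 d] by metis
  have "w z * cmod (Imu mu f z) < e" if z: "r < cmod z" "cmod z < 1" for z
  proof -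
    have "w z * cmod (Imu mu f z) \<le> wnorm v f * (w z * K (cmod z))"
      by (rule weighted_Imu_le[OF f z(2)])
    also have "\<dots> \<le> wnorm v f * d" using r(2)[OF z] N by (intro mult_left_mono) auto
    also have "\<dots> < (wnorm v f + 1) * d" using d by (intro mult_strict_right_mono) auto
    also have "\<dots> = e" using N by (simp add: d_def)
    finally show ?thesis .
  qed
  then show "\<exists>r<1. \<forall>z. r < cmod z \<and> cmod z < 1 \<longrightarrow> w z * cmod (Imu mu f z) < e"
    using r(1) by blast
qed

lemma Imu_maps_iff: "Imu_maps mu v Y \<longleftrightarrow> (\<forall>f\<in>Hinf v. Imu mu f \<in> Y)"
  unfolding Imu_maps_def using integrable_Imu by auto

text \<open>On compact subsets of the disc \<open>1 / v\<close> is bounded, so the unit ball is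
  locally bounded and Montel's theorem applies. The inequality
  \<open>v z * cmod (h z) \<le> 1\<close> survives pointwise limits.\<close>

lemma unit_ball_subsequence:
  assumes "\<And>n. F n \<in> Hinf v" "\<And>n. wnorm v (F n) \<le> 1"
  obtains f \<phi> where "f \<in> Hinf v" "wnorm v f \<le> 1" "strict_mono (\<phi> :: nat \<Rightarrow> nat)"
    "\<And>z. cmod z < 1 \<Longrightarrow> (\<lambda>n. F (\<phi> n) z) \<longlonglongrightarrow> f z"
proof -
  let ?U = "{h \<in> Hinf v. wnorm v h \<le> 1}"
  have bound: "v z * cmod (h z) \<le> 1" if "h \<in> ?U" "cmod z < 1" for h z
    using wnorm_upper[of h v z] that by auto
  obtain f \<phi> where f: "f holomorphic_on ball 0 1" "strict_mono (\<phi> :: nat \<Rightarrow> nat)"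
    "\<And>z. z \<in> ball 0 1 \<Longrightarrow> (\<lambda>n. F (\<phi> n) z) \<longlonglongrightarrow> f z"
  proof (rule Montel[of "ball 0 1" ?U F])
    show "open (ball 0 1 :: complex set)" by simp
    show "h holomorphic_on ball 0 1" if "h \<in> ?U" for h using that Hinf_holomorphic by auto
    show "range F \<subseteq> ?U" using assms by auto
    fix C :: "complex set" assume C: "compact C" "C \<subseteq> ball 0 1"
    have "v z \<noteq> 0" if "z \<in> C" for z
    proof -
      have "cmod z < 1" using that C by auto
      then show ?thesis using weight_pos[OF v, of z] by simp
    qed
    then have "continuous_on C (\<lambda>z. 1 / v z)"
      using continuous_on_subset[OF weight_continuous[OF v] C(2)] by (intro continuous_intros) auto
    then have "bdd_above ((\<lambda>z. 1 / v z) ` C)"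
      by (intro bounded_imp_bdd_above compact_imp_bounded compact_continuous_image C)
    then obtain B where B: "\<And>z. z \<in> C \<Longrightarrow> 1 / v z \<le> B"
      by (auto simp: bdd_above_def)
    have "cmod (h z) \<le> B" if "h \<in> ?U" "z \<in> C" for h z
    proof -
      have z: "cmod z < 1" using that C by auto
      have "cmod (h z) \<le> 1 / v z"
        using bound[OF that(1) z] weight_pos[OF v z] by (simp add: field_simps)
      then show ?thesis using B[OF that(2)] by simp
    qed
    then show "\<exists>B. \<forall>h\<in>?U. \<forall>z\<in>C. cmod (h z) \<le> B" by blast
  qed blast
  have le: "v z * cmod (f z) \<le> 1" if z: "cmod z < 1" for z
  proof (rule tendsto_upperbound)
    show "(\<lambda>n. v z * cmod (F (\<phi> n) z)) \<longlonglongrightarrow> v z * cmod (f z)"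
      using f(3)[of z] z by (intro tendsto_intros) auto
    show "\<forall>\<^sub>F n in sequentially. v z * cmod (F (\<phi> n) z) \<le> 1"
      using bound assms z by (intro always_eventually) auto
  qed simp
  show ?thesis
    by (rule that[of f \<phi>]) (use f le in \<open>auto intro: HinfI wnorm_le\<close>)
qed

text \<open>A radius \<open>r\<close> is fixed first: beyond it \<open>w K\<close> is small
  independently of \<open>n\<close>. Inside it the L1 estimate makes the difference of the images
  small for large \<open>n\<close>.\<close>

lemma compact_of_kernel_decay:
  assumes C1: "((\<lambda>r. w (complex_of_real r) * K r) \<longlongrightarrow> 0) (at_left 1)"
  shows "compact_op v w (H0 w) (Imu mu)"
  unfolding compact_op_def
proof (intro allI impI)
  fix F :: "nat \<Rightarrow> complex \<Rightarrow> complex" assume F: "\<forall>n. F n \<in> Hinf v \<and> wnorm v (F n) \<le> 1"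
  obtain f \<phi> where f: "f \<in> Hinf v" "wnorm v f \<le> 1" "strict_mono (\<phi> :: nat \<Rightarrow> nat)"
    "\<And>z. cmod z < 1 \<Longrightarrow> (\<lambda>n. F (\<phi> n) z) \<longlonglongrightarrow> f z"
    using unit_ball_subsequence[of F] F by auto
  have F': "F (\<phi> n) \<in> Hinf v" "wnorm v (F (\<phi> n)) \<le> 1" for n using F by auto
  have maps: "Imu mu h \<in> Hinf w" if "h \<in> Hinf v" for h
    using Imu_in_H0_of_kernel_decay[OF C1 that] H0_subset_Hinf by auto
  define a where "a n = (LINT t|mu. cmod (F (\<phi> n) (complex_of_real t) - f (complex_of_real t)))" for n
  have a: "a \<longlonglongrightarrow> 0" unfolding a_def by (rule L1_convergence[OF F' f(1,4)])
  have "(\<lambda>n. wnorm w (\<lambda>z. Imu mu (F (\<phi> n)) z - Imu mu f z)) \<longlonglongrightarrow> 0"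
  proof (rule LIMSEQ_I)
    fix e :: real assume e: "0 < e"
    \<comment> \<open>Two elements of the unit ball are at distance at most 2, so
      \<open>e / 4\<close> for \<open>w K\<close> yields \<open>e / 2\<close> for the
      images.\<close>
    obtain r where r: "0 \<le> r" "r < 1" "\<And>z. r < cmod z \<Longrightarrow> cmod z < 1 \<Longrightarrow> w z * K (cmod z) < e / 4"
      using kernel_decay[OF C1, of "e / 4"] e by auto
    have "(\<lambda>n. w 0 * (a n / (1 - r))) \<longlonglongrightarrow> w 0 * (0 / (1 - r))"
      using r by (intro tendsto_intros a) auto
    then have "\<forall>\<^sub>F n in sequentially. w 0 * (a n / (1 - r)) < e / 2"
      using e by (intro order_tendstoD(2)) auto
    then obtain N where N: "\<And>n. N \<le> n \<Longrightarrow> w 0 * (a n / (1 - r)) < e / 2"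
      by (auto simp: eventually_sequentially)
    have "norm (wnorm w (\<lambda>z. Imu mu (F (\<phi> n)) z - Imu mu f z) - 0) < e" if n: "N \<le> n" for n
    proof -
      let ?h = "\<lambda>z. F (\<phi> n) z - f z"
      have h: "?h \<in> Hinf v" by (rule Hinf_diff[OF v F'(1) f(1)])
      have "wnorm v ?h \<le> 2"
      proof (rule wnorm_le)
        fix z :: complex assume z: "cmod z < 1"
        have "v z * cmod (F (\<phi> n) z - f z) \<le> v z * (cmod (F (\<phi> n) z) + cmod (f z))"
          using weight_pos[OF v z] norm_triangle_ineq4 by (intro mult_left_mono) auto
        also have "\<dots> \<le> 2"
          using wnorm_upper[OF F'(1) z, of n] wnorm_upper[OF f(1) z] F'(2)[of n] f(2)
          unfolding distrib_left by linarith
        finally show "v z * cmod (F (\<phi> n) z - f z) \<le> 2" .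
      qed
      have "wnorm w (\<lambda>z. Imu mu (F (\<phi> n)) z - Imu mu f z) \<le> e / 2"
      proof (rule wnorm_le)
        fix z :: complex assume z: "cmod z < 1"
        show "w z * cmod (Imu mu (F (\<phi> n)) z - Imu mu f z) \<le> e / 2"
        proof (cases "cmod z \<le> r")
          case True
          have "w z * cmod (Imu mu (F (\<phi> n)) z - Imu mu f z) \<le> w 0 * (a n / (1 - r))"
            using Imu_diff_le_L1[OF F'(1)[of n] f(1) True r(2)] weight_antimono[OF w, of 0 z] z
              weight_pos[OF w, of 0]
            unfolding a_def by (intro mult_mono) auto
          then show ?thesis using N[OF n] by linarith
        next
          case False
          have wK: "w z * K (cmod z) < e / 4" using r(3) False z by simp
          have "0 \<le> (w z * K (cmod z))"
            unfolding K_def using z weight_pos[OF w z] v_pos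
            by (intro mult_nonneg_nonneg Bochner_Integration.integral_nonneg divide_nonneg_nonneg)
              (auto simp: space_mu less_imp_le mult_le_one)
          then have "wnorm v ?h * (w z * K (cmod z)) \<le> 2 * (w z * K (cmod z))"
            using \<open>wnorm v ?h \<le> 2\<close> by (intro mult_right_mono)
          then show ?thesis
            using weighted_Imu_le[OF h z] Imu_diff[OF F'(1)[of n] f(1) z] wK by simp
        qed
      qed
      moreover have "0 \<le> wnorm w (\<lambda>z. Imu mu (F (\<phi> n)) z - Imu mu f z)"
        by (intro wnorm_nonneg[OF w] Hinf_diff[OF w] maps F' f)
      ultimately show ?thesis using e by simp
    qed
    then show "\<exists>N. \<forall>n\<ge>N. norm (wnorm w (\<lambda>z. Imu mu (F (\<phi> n)) z - Imu mu f z) - 0) < e"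
      by blast
  qed
  then show "\<exists>\<phi> g. strict_mono \<phi> \<and> g \<in> H0 w \<and> (\<lambda>n. wnorm w (\<lambda>z. Imu mu (F (\<phi> n)) z - g z)) \<longlonglongrightarrow> 0"
    using f(3) Imu_in_H0_of_kernel_decay[OF C1 f(1)] by blast
qed

text \<open>The modulus of the kernel at \<open>z\<close> is at most its value at
  \<open>cmod z\<close>, so the image of \<open>f\<close> is bounded by \<open>B\<close> times the
  image of 1 at \<open>cmod z\<close>. Radiality of \<open>w\<close> then transfers the
  decay.\<close>

lemma Imu_bounded_in_H0:
  assumes I1: "Imu mu (\<lambda>_. 1) \<in> H0 w" and f: "f holomorphic_on ball 0 1"
    and B: "\<And>z. cmod z < 1 \<Longrightarrow> cmod (f z) \<le> B"
  shows "Imu mu f \<in> H0 w"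
proof -
  have B0: "0 \<le> B" using order_trans[OF norm_ge_zero B[of 0]] by simp
  have fv: "f \<in> Hinf v" by (rule bounded_holomorphic_in_Hinf[OF v f B])
  have le: "cmod (Imu mu f z) \<le> B * cmod (Imu mu (\<lambda>_. 1) (complex_of_real (cmod z)))" if z: "cmod z < 1" for z
  proof -
    have eq: "1 / (1 - complex_of_real t * complex_of_real (cmod z)) = complex_of_real (1 / (1 - t * cmod z))" for t
      by simp
    have int: "integrable mu (\<lambda>t. 1 / (1 - t * cmod z))"
      using integrable_Imu[OF const_in_Hinf, of "complex_of_real (cmod z)" 1] z
      unfolding eq by (simp only: complex_of_real_integrable_eq) (simp add: norm_mult)
    have I1eq: "Imu mu (\<lambda>_. 1) (complex_of_real (cmod z)) = complex_of_real (LINT t|mu. 1 / (1 - t * cmod z))"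
      unfolding Imu_def eq by (rule integral_complex_of_real)
    have "cmod (Imu mu f z) \<le> (LINT t|mu. cmod (f (complex_of_real t) / (1 - complex_of_real t * z)))"
      unfolding Imu_def by (rule integral_norm_bound)
    also have "\<dots> \<le> (LINT t|mu. B * (1 / (1 - t * cmod z)))"
    proof (rule integral_mono)
      fix t assume "t \<in> space mu"
      then have t: "0 \<le> t" "t < 1" by (auto simp: space_mu)
      note k = kernel_bounds[OF t order_refl z]
      have "cmod (f (complex_of_real t)) / cmod (1 - complex_of_real t * z) \<le> B / (1 - t * cmod z)"
        using k z B[of "complex_of_real t"] t B0 by (intro frac_le) auto
      then show "cmod (f (complex_of_real t) / (1 - complex_of_real t * z)) \<le> B * (1 / (1 - t * cmod z))"
        by (simp add: norm_divide)
    next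
      show "integrable mu (\<lambda>t. cmod (f (complex_of_real t) / (1 - complex_of_real t * z)))"
        by (intro integrable_norm integrable_Imu fv z)
      show "integrable mu (\<lambda>t. B * (1 / (1 - t * cmod z)))"
        by (intro integrable_mult_right int)
    qed
    also have "\<dots> = B * (LINT t|mu. 1 / (1 - t * cmod z))" by (rule integral_mult_right_zero)
    also have "\<dots> \<le> B * cmod (Imu mu (\<lambda>_. 1) (complex_of_real (cmod z)))"
      unfolding I1eq using B0 by (intro mult_left_mono) auto
    finally show ?thesis .
  qed
  show ?thesis
  proof (rule H0I[OF w Imu_holomorphic[OF fv]])
    fix e :: real assume e: "0 < e"
    obtain r where r: "r < 1" "\<And>z. r < cmod z \<Longrightarrow> cmod z < 1 \<Longrightarrow> w z * cmod (B * Imu mu (\<lambda>_. 1) z) < e"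
      using H0D[OF H0_scale[OF w I1, of "complex_of_real B"] e] by metis
    have "w z * cmod (Imu mu f z) < e" if z: "r < cmod z" "cmod z < 1" for z
    proof -
      have "w z * cmod (Imu mu f z) \<le> w z * (B * cmod (Imu mu (\<lambda>_. 1) (complex_of_real (cmod z))))"
        using le[OF z(2)] weight_pos[OF w z(2)] by (intro mult_left_mono) auto
      also have "\<dots> = w (complex_of_real (cmod z)) * cmod (B * Imu mu (\<lambda>_. 1) (complex_of_real (cmod z)))"
        using weight_radial[OF w z(2)] B0 by (simp add: norm_mult)
      also have "\<dots> < e" using r(2)[of "complex_of_real (cmod z)"] z by simp
      finally show ?thesis .
    qed
    then show "\<exists>r<1. \<forall>z. r < cmod z \<and> cmod z < 1 \<longrightarrow> w z * cmod (Imu mu f z) < e"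
      using r(1) by blast
  qed
qed

text \<open>The dilated function only sees \<open>f\<close> on a compact disc, which makes it
  bounded; as \<open>v\<close> does not increase with the modulus, the norm cannot grow.\<close>

lemma dilation:
  assumes f: "f \<in> Hinf v" and r: "0 \<le> r" "r < 1"
  shows "(\<lambda>z. f (complex_of_real r * z)) holomorphic_on ball 0 1"
    and "\<exists>B. \<forall>z. cmod z < 1 \<longrightarrow> cmod (f (complex_of_real r * z)) \<le> B"
    and "wnorm v (\<lambda>z. f (complex_of_real r * z)) \<le> wnorm v f"
proof -
  have rz: "cmod (complex_of_real r * z) \<le> r" "cmod (complex_of_real r * z) \<le> cmod z" if "cmod z < 1" for z
    using that r by (auto simp: norm_mult mult_left_le mult_left_le_one_le)
  have "(f \<circ> (\<lambda>z. complex_of_real r * z)) holomorphic_on ball 0 1"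
    by (rule holomorphic_on_compose_gen[OF _ Hinf_holomorphic[OF f]])
      (use rz r in \<open>force intro!: holomorphic_intros\<close>)+
  then show "(\<lambda>z. f (complex_of_real r * z)) holomorphic_on ball 0 1" by (simp add: o_def)
  have "continuous_on (cball 0 r) f"
    by (rule continuous_on_subset[OF holomorphic_on_imp_continuous_on[OF Hinf_holomorphic[OF f]]]) (use r in auto)
  then have "bounded (f ` cball 0 r)"
    by (intro compact_imp_bounded compact_continuous_image) auto
  then obtain B where "\<And>z. z \<in> cball 0 r \<Longrightarrow> cmod (f z) \<le> B"
    unfolding bounded_iff by blast
  then show "\<exists>B. \<forall>z. cmod z < 1 \<longrightarrow> cmod (f (complex_of_real r * z)) \<le> B"
    using rz by (intro exI[of _ B]) simp
  show "wnorm v (\<lambda>z. f (complex_of_real r * z)) \<le> wnorm v f"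
  proof (rule wnorm_le)
    fix z :: complex assume z: "cmod z < 1"
    have rz1: "cmod (complex_of_real r * z) < 1" using rz[OF z] z by linarith
    have "v z * cmod (f (complex_of_real r * z)) \<le> v (complex_of_real r * z) * cmod (f (complex_of_real r * z))"
      using weight_antimono[OF v rz(2)[OF z] z] by (intro mult_right_mono) auto
    also have "\<dots> \<le> wnorm v f" by (rule wnorm_upper[OF f rz1])
    finally show "v z * cmod (f (complex_of_real r * z)) \<le> wnorm v f" .
  qed
qed

text \<open>The images of the dilations have a subsequence with a norm limit \<open>g\<close> in
  \<open>H0 w\<close>. Convergence in L1 identifies their pointwise limit as
  \<open>Imu mu f\<close>, so \<open>g\<close> agrees with it on the disc.\<close>

lemma Imu_in_H0_of_compact:
  assumes comp: "compact_op v w (Hinf w) (Imu mu)"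
    and I1: "Imu mu (\<lambda>_. 1) \<in> H0 w" and f: "f \<in> Hinf v" "wnorm v f \<le> 1"
  shows "Imu mu f \<in> H0 w"
proof -
  define \<rho> where "\<rho> n = 1 - inverse (real (Suc n))" for n
  have \<rho>: "0 \<le> \<rho> n" "\<rho> n < 1" for n by (auto simp: \<rho>_def field_simps)
  have \<rho>_lim: "\<rho> \<longlonglongrightarrow> 1"
    using LIMSEQ_inverse_real_of_nat_add_minus[of 1] by (simp add: \<rho>_def[abs_def])
  define F where "F n z = f (complex_of_real (\<rho> n) * z)" for n z
  have F: "F n \<in> Hinf v" "Imu mu (F n) \<in> H0 w" for n
  proof -
    obtain B where B: "\<And>z. cmod z < 1 \<Longrightarrow> cmod (F n z) \<le> B"
      using dilation(2)[OF f(1) \<rho>[of n]] unfolding F_def by blast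
    have hol: "F n holomorphic_on ball 0 1"
      unfolding F_def by (rule dilation(1)[OF f(1) \<rho>])
    show "F n \<in> Hinf v" by (rule bounded_holomorphic_in_Hinf[OF v hol B])
    show "Imu mu (F n) \<in> H0 w" by (rule Imu_bounded_in_H0[OF I1 hol B])
  qed
  have F1: "wnorm v (F n) \<le> 1" for n
    unfolding F_def using dilation(3)[OF f(1) \<rho>] f(2) order_trans by blast
  have lim: "(\<lambda>n. F n z) \<longlonglongrightarrow> f z" if z: "cmod z < 1" for z
  proof -
    have "isCont f z"
      using Hinf_holomorphic[OF f(1)] z
      by (intro continuous_on_interior[OF holomorphic_on_imp_continuous_on]) auto
    moreover have "(\<lambda>n. complex_of_real (\<rho> n) * z) \<longlonglongrightarrow> complex_of_real 1 * z"
      by (intro tendsto_intros \<rho>_lim)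
    ultimately show ?thesis
      unfolding F_def by (intro isCont_tendsto_compose[of _ f]) auto
  qed
  obtain \<phi> g where g: "strict_mono (\<phi> :: nat \<Rightarrow> nat)" "g \<in> Hinf w"
    "(\<lambda>n. wnorm w (\<lambda>z. Imu mu (F (\<phi> n)) z - g z)) \<longlonglongrightarrow> 0"
    using comp F F1 unfolding compact_op_def by blast
  have gH0: "g \<in> H0 w" by (rule H0_closed[OF w g(2) F(2) g(3)])
  have eq: "g z = Imu mu f z" if z: "cmod z < 1" for z
  proof -
    have "(\<lambda>n. (LINT t|mu. cmod (F (\<phi> n) (complex_of_real t) - f (complex_of_real t))) / (1 - cmod z)) \<longlonglongrightarrow> 0 / (1 - cmod z)"
    proof (intro tendsto_intros L1_convergence F(1) F1 f(1))
      show "(\<lambda>n. F (\<phi> n) y) \<longlonglongrightarrow> f y" if "cmod y < 1" for y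
        using LIMSEQ_subseq_LIMSEQ[OF lim[OF that] g(1)] by (simp add: o_def)
      show "1 - cmod z \<noteq> 0" using z by simp
    qed
    then have "(\<lambda>n. (LINT t|mu. cmod (F (\<phi> n) (complex_of_real t) - f (complex_of_real t))) / (1 - cmod z)) \<longlonglongrightarrow> 0"
      by simp
    then have "(\<lambda>n. Imu mu (F (\<phi> n)) z - Imu mu f z) \<longlonglongrightarrow> 0"
      by (rule Lim_null_comparison[rotated]) (intro always_eventually allI Imu_diff_le_L1 F(1) f(1) order_refl z)
    then have 1: "(\<lambda>n. Imu mu (F (\<phi> n)) z) \<longlonglongrightarrow> Imu mu f z" by (rule LIM_zero_cancel)
    have "(\<lambda>n. wnorm w (\<lambda>z. Imu mu (F (\<phi> n)) z - g z) / w z) \<longlonglongrightarrow> 0 / w z"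
      using weight_pos[OF w z] by (intro tendsto_intros g(3)) auto
    moreover have "cmod (Imu mu (F (\<phi> n)) z - g z) \<le> wnorm w (\<lambda>z. Imu mu (F (\<phi> n)) z - g z) / w z" for n
      using F H0_subset_Hinf by (intro Hinf_bound[OF w _ z] Hinf_diff[OF w _ g(2)]) auto
    ultimately have "(\<lambda>n. Imu mu (F (\<phi> n)) z - g z) \<longlonglongrightarrow> 0"
      by (intro Lim_null_comparison[of "\<lambda>n. Imu mu (F (\<phi> n)) z - g z"
            "\<lambda>n. wnorm w (\<lambda>z. Imu mu (F (\<phi> n)) z - g z) / w z"]) simp_all
    then have "(\<lambda>n. Imu mu (F (\<phi> n)) z) \<longlonglongrightarrow> g z" by (rule LIM_zero_cancel)
    then show ?thesis using 1 LIMSEQ_unique by blast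
  qed
  \<comment> \<open>Agreement of \<open>g\<close> and \<open>Imu mu f\<close> is known on the disc
    only, so the decay is transferred rather than one function replaced by the other.\<close>
  show ?thesis
  proof (rule H0I[OF w Imu_holomorphic[OF f(1)]])
    fix e :: real assume e: "0 < e"
    obtain r where r: "r < 1" "\<And>z. r < cmod z \<Longrightarrow> cmod z < 1 \<Longrightarrow> w z * cmod (g z) < e"
      using H0D[OF gH0 e] by metis
    then show "\<exists>r<1. \<forall>z. r < cmod z \<and> cmod z < 1 \<longrightarrow> w z * cmod (Imu mu f z) < e"
      using eq by auto
  qed
qed

text \<open>Dividing by any positive bound \<open>d\<close> of the norm, rather than by the norm
  itself, includes the zero function.\<close>

lemma normalise:
  assumes f: "f \<in> Hinf v" and d: "0 < d" "wnorm v f \<le> d"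
  shows "(\<lambda>z. complex_of_real (1 / d) * f z) \<in> Hinf v"
    and "wnorm v (\<lambda>z. complex_of_real (1 / d) * f z) \<le> 1"
    and "Imu mu f = (\<lambda>z. complex_of_real d * Imu mu (\<lambda>z. complex_of_real (1 / d) * f z) z)"
proof -
  show "(\<lambda>z. complex_of_real (1 / d) * f z) \<in> Hinf v"
    using Hinf_lincomb[OF v f f, of "complex_of_real (1 / d)" 0] by simp
  show "wnorm v (\<lambda>z. complex_of_real (1 / d) * f z) \<le> 1"
  proof (rule wnorm_le)
    fix z :: complex assume z: "cmod z < 1"
    have "v z * cmod (f z) \<le> d" using wnorm_upper[OF f z] d by simp
    then show "v z * cmod (complex_of_real (1 / d) * f z) \<le> 1"
      using d by (simp add: norm_divide field_simps)
  qed
  show "Imu mu f = (\<lambda>z. complex_of_real d * Imu mu (\<lambda>z. complex_of_real (1 / d) * f z) z)"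
    using d by (simp add: Imu_scale fun_eq_iff del: of_real_divide flip: mult.assoc of_real_mult)
qed

lemma Imu_maps_H0_of_compact:
  assumes "compact_op v w (Hinf w) (Imu mu)" "Imu mu (\<lambda>_. 1) \<in> H0 w"
  shows "Imu_maps mu v (H0 w)"
  unfolding Imu_maps_iff
proof
  fix f assume f: "f \<in> Hinf v"
  have d: "0 < wnorm v f + 1" "wnorm v f \<le> wnorm v f + 1" using wnorm_nonneg[OF v f] by auto
  note n = normalise[OF f d]
  show "Imu mu f \<in> H0 w"
    by (subst n(3)) (rule H0_scale[OF w Imu_in_H0_of_compact[OF assms n(1,2)]])
qed

text \<open>Images of the unit ball with norms exceeding every \<open>n\<close> would have no norm
  convergent subsequence, so the operator is bounded there; linearity then gives continuity.\<close>

lemma continuous_of_compact: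
  assumes maps: "Imu_maps mu v (Hinf w)" and comp: "compact_op v w (Hinf w) (Imu mu)"
  shows "continuous_op v w (Imu mu)"
proof -
  have I: "Imu mu f \<in> Hinf w" if "f \<in> Hinf v" for f using maps that by (simp add: Imu_maps_iff)
  have "\<exists>M. \<forall>f. f \<in> Hinf v \<and> wnorm v f \<le> 1 \<longrightarrow> wnorm w (Imu mu f) \<le> M"
  proof (rule ccontr)
    assume "\<not> ?thesis"
    then have "\<forall>n::nat. \<exists>f. f \<in> Hinf v \<and> wnorm v f \<le> 1 \<and> real n < wnorm w (Imu mu f)"
      by (meson not_le)
    then obtain F where F: "\<And>n. F n \<in> Hinf v" "\<And>n. wnorm v (F n) \<le> 1"
        "\<And>n::nat. real n < wnorm w (Imu mu (F n))"
      by metis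
    obtain \<phi> g where g: "strict_mono (\<phi> :: nat \<Rightarrow> nat)" "g \<in> Hinf w"
      "(\<lambda>n. wnorm w (\<lambda>z. Imu mu (F (\<phi> n)) z - g z)) \<longlonglongrightarrow> 0"
      using comp F unfolding compact_op_def by blast
    have "\<forall>\<^sub>F n in sequentially. wnorm w (\<lambda>z. Imu mu (F (\<phi> n)) z - g z) < 1"
      by (rule order_tendstoD(2)[OF g(3)]) simp
    moreover have "\<forall>\<^sub>F n in sequentially. 1 + wnorm w g < real n"
      using filterlim_real_sequentially by (simp add: filterlim_at_top_dense)
    ultimately have "\<forall>\<^sub>F n in sequentially. wnorm w (\<lambda>z. Imu mu (F (\<phi> n)) z - g z) < 1 \<and> 1 + wnorm w g < real n"
      by eventually_elim simp
    then obtain n where n: "wnorm w (\<lambda>z. Imu mu (F (\<phi> n)) z - g z) < 1" "1 + wnorm w g < real n"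
      using eventually_happens by force
    \<comment> \<open>A strictly increasing \<open>\<phi>\<close> satisfies
      \<open>n \<le> \<phi> n\<close>, so the norms along the subsequence still exceed
      \<open>n\<close>.\<close>
    have "real n \<le> real (\<phi> n)" using seq_suble[OF g(1)] by simp
    also have "\<dots> < wnorm w (Imu mu (F (\<phi> n)))" by (rule F(3))
    also have "\<dots> \<le> wnorm w (\<lambda>z. Imu mu (F (\<phi> n)) z - g z) + wnorm w g"
      by (intro wnorm_triangle[OF w] Hinf_diff[OF w] I F g)
    finally show False using n by simp
  qed
  then obtain M where M: "\<And>f. f \<in> Hinf v \<Longrightarrow> wnorm v f \<le> 1 \<Longrightarrow> wnorm w (Imu mu f) \<le> M"
    by blast
  show ?thesis
    unfolding continuous_op_def
  proof (intro ballI allI impI)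
    fix f and e :: real assume f: "f \<in> Hinf v" and e: "0 < e"
    \<comment> \<open>The denominator is positive whatever the sign of \<open>M\<close>, and the
      factor 2 leaves room for the strict inequality.\<close>
    define d where "d = e / (2 * (\<bar>M\<bar> + 1))"
    have d: "0 < d" using e by (simp add: d_def add_nonneg_pos)
    have dM: "d * (\<bar>M\<bar> + 1) = e / 2"
      using add_nonneg_pos[OF abs_ge_zero[of M] zero_less_one] by (simp add: d_def field_simps)
    have "wnorm w (\<lambda>z. Imu mu g z - Imu mu f z) < e"
      if g: "g \<in> Hinf v" "wnorm v (\<lambda>z. g z - f z) < d" for g
    proof -
      note n = normalise[OF Hinf_diff[OF v g(1) f] d less_imp_le[OF g(2)]]
      let ?h = "\<lambda>z. complex_of_real (1 / d) * (g z - f z)"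
      have "wnorm w (\<lambda>z. Imu mu g z - Imu mu f z) \<le> d * (\<bar>M\<bar> + 1)"
      proof (rule wnorm_le)
        fix z :: complex assume z: "cmod z < 1"
        have "w z * cmod (Imu mu g z - Imu mu f z) = w z * cmod (complex_of_real d * Imu mu ?h z)"
          using Imu_diff[OF g(1) f z] fun_cong[OF n(3), of z] by simp
        also have "\<dots> = d * (w z * cmod (Imu mu ?h z))" using d by (simp add: norm_mult)
        also have "\<dots> \<le> d * (\<bar>M\<bar> + 1)"
          using wnorm_upper[OF I[OF n(1)] z] M[OF n(1,2)] d by (intro mult_left_mono) auto
        finally show "w z * cmod (Imu mu g z - Imu mu f z) \<le> d * (\<bar>M\<bar> + 1)" .
      qed
      then show ?thesis using dM e by simp
    qed
    then show "\<exists>d>0. \<forall>g\<in>Hinf v. wnorm v (\<lambda>z. g z - f z) < d \<longrightarrow> wnorm w (\<lambda>z. Imu mu g z - Imu mu f z) < e"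
      using d by blast
  qed
qed

text \<open>One image suffices: the test function is at least \<open>c / v\<close> on
  \<open>[0, 1)\<close> and the kernel is positive at real \<open>r\<close>, so
  \<open>c * K r\<close> is bounded by the modulus of \<open>Imu mu f\<close> at \<open>r\<close>,
  which decays against \<open>w\<close>.\<close>

lemma kernel_decay_of_essential:
  assumes ess: "essential_weight v" and maps: "Imu_maps mu v (H0 w)"
  shows "((\<lambda>r. w (complex_of_real r) * K r) \<longlongrightarrow> 0) (at_left 1)"
proof -
  obtain f g c where f: "f \<in> Hinf v" "0 < c"
    "\<And>r. 0 \<le> r \<Longrightarrow> r < 1 \<Longrightarrow> f (complex_of_real r) = complex_of_real (g r)"
    "\<And>r. 0 \<le> r \<Longrightarrow> r < 1 \<Longrightarrow> c / v (complex_of_real r) \<le> g r"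
    using essential_weight_test_function[OF v ess] by metis
  have If: "Imu mu f \<in> H0 w" using maps f(1) by (simp add: Imu_maps_iff)
  have le: "c * K r \<le> cmod (Imu mu f (complex_of_real r))" and nonneg: "0 \<le> K r" if r: "0 \<le> r" "r < 1" for r
  proof -
    have cr: "cmod (complex_of_real r) < 1" using r by simp
    have eq: "f (complex_of_real t) / (1 - complex_of_real t * complex_of_real r) = complex_of_real (g t / (1 - t * r))"
      if "t \<in> space mu" for t using f(3)[of t] that by (simp add: space_mu)
    have k: "0 < 1 - t * r" if "t \<in> space mu" for t
      using kernel_bounds(1)[of t "complex_of_real r" r] that r by (simp add: space_mu)
    have "integrable mu (\<lambda>t. complex_of_real (g t / (1 - t * r)))"
      by (rule Bochner_Integration.integrable_cong[OF refl eq, THEN iffD1, OF _ integrable_Imu[OF f(1) cr]])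
    then have int: "integrable mu (\<lambda>t. g t / (1 - t * r))" by (simp only: complex_of_real_integrable_eq)
    have "Imu mu f (complex_of_real r) = (LINT t|mu. complex_of_real (g t / (1 - t * r)))"
      unfolding Imu_def by (rule Bochner_Integration.integral_cong[OF refl eq])
    also have "\<dots> = complex_of_real (LINT t|mu. g t / (1 - t * r))" by (rule integral_complex_of_real)
    finally have I: "Imu mu f (complex_of_real r) = complex_of_real (LINT t|mu. g t / (1 - t * r))" .
    have "c * K r = (LINT t|mu. c * (1 / (v (complex_of_real t) * (1 - t * r))))"
      unfolding K_def by (rule integral_mult_right_zero[symmetric])
    also have "\<dots> \<le> (LINT t|mu. g t / (1 - t * r))"
    proof (rule integral_mono)
      fix t assume t: "t \<in> space mu"
      have "c / v (complex_of_real t) / (1 - t * r) \<le> g t / (1 - t * r)"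
        using f(4)[of t] t k[OF t] by (intro divide_right_mono) (auto simp: space_mu)
      then show "c * (1 / (v (complex_of_real t) * (1 - t * r))) \<le> g t / (1 - t * r)" by simp
    qed (intro integrable_mult_right integrable_K r int)+
    also have "\<dots> \<le> cmod (Imu mu f (complex_of_real r))" unfolding I by simp
    finally show "c * K r \<le> cmod (Imu mu f (complex_of_real r))" .
    show "0 \<le> K r"
      unfolding K_def using k v_pos
      by (intro Bochner_Integration.integral_nonneg divide_nonneg_nonneg mult_nonneg_nonneg)
        (auto simp: space_mu less_imp_le)
  qed
  show ?thesis
  proof (rule tendstoI)
    fix e :: real assume e: "0 < e"
    have ce: "0 < c * e" using f(2) e by simp
    obtain r where r: "0 \<le> r" "r < 1" "\<And>z. r < cmod z \<Longrightarrow> cmod z < 1 \<Longrightarrow> w z * cmod (Imu mu f z) < c * e"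
      using H0D[OF If ce] by blast
    have "dist (w (complex_of_real s) * K s) 0 < e" if s: "r < s" "s < 1" for s
    proof -
      have s0: "0 \<le> s" using r s by simp
      have ws: "0 < w (complex_of_real s)" using weight_pos[OF w, of "complex_of_real s"] s s0 by simp
      have "c * (w (complex_of_real s) * K s) \<le> w (complex_of_real s) * cmod (Imu mu f (complex_of_real s))"
        using mult_left_mono[OF le[OF s0 s(2)], of "w (complex_of_real s)"] ws by (simp add: mult_ac)
      also have "\<dots> < c * e" using r(3)[of "complex_of_real s"] s s0 by simp
      finally have "w (complex_of_real s) * K s < e" using f(2) by simp
      then show ?thesis using ws nonneg[OF s0 s(2)] by (simp add: abs_mult)
    qed
    then show "\<forall>\<^sub>F s in at_left 1. dist (w (complex_of_real s) * K s) 0 < e"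
      unfolding eventually_at_left_field using r(2) by blast
  qed
qed

text \<open>The target space enters \<open>compact_op\<close> only as the place where the limit must
  lie.\<close>

lemma compact_op_mono: "compact_op v w Y T \<Longrightarrow> Y \<subseteq> Z \<Longrightarrow> compact_op v w Z T"
  unfolding compact_op_def by blast

end

theorem theorem12:
  fixes mu :: "real measure" and v w :: "complex \<Rightarrow> real"
  assumes "finite_measure mu"
    and "sets mu = sets (restrict_space borel {0..<1::real})"
    and "is_weight v" and "is_weight w"
    and "integrable mu (\<lambda>t. 1 / v (complex_of_real t))"
  defines "C1 \<equiv> ((\<lambda>r. w (complex_of_real r) *
                   (LINT t|mu. 1 / (v (complex_of_real t) * (1 - t * r)))) \<longlongrightarrow> 0) (at_left 1)"
    and "C2 \<equiv> Imu_maps mu v (H0 w) \<and> compact_op v w (H0 w) (Imu mu)"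
    and "C3 \<equiv> Imu_maps mu v (Hinf w) \<and> compact_op v w (Hinf w) (Imu mu)
              \<and> Imu mu (\<lambda>_. 1) \<in> H0 w"
    and "C4 \<equiv> Imu_maps mu v (H0 w) \<and> continuous_op v w (Imu mu)"
  shows "(C1 \<longrightarrow> C2) \<and> (C2 \<longrightarrow> C3) \<and> (C3 \<longrightarrow> C4) \<and>
         (essential_weight v \<longrightarrow> (C1 \<longleftrightarrow> C2) \<and> (C2 \<longleftrightarrow> C3) \<and> (C3 \<longleftrightarrow> C4))"
proof -
  interpret Imu_setting mu v w
    using assms by (intro Imu_setting.intro Imu_setting_axioms.intro)
  have C1: "C1 \<longleftrightarrow> ((\<lambda>r. w (complex_of_real r) * K r) \<longlongrightarrow> 0) (at_left 1)"
    by (simp add: C1_def K_def)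
  have 12: "C1 \<longrightarrow> C2"
    using C1 compact_of_kernel_decay Imu_in_H0_of_kernel_decay by (simp add: C2_def Imu_maps_iff)
  have 23: "C2 \<longrightarrow> C3"
    using H0_subset_Hinf[of w] const_in_Hinf[of 1] compact_op_mono[OF _ H0_subset_Hinf]
    by (auto simp: C2_def C3_def Imu_maps_iff)
  have 34: "C3 \<longrightarrow> C4"
    using Imu_maps_H0_of_compact continuous_of_compact by (simp add: C3_def C4_def)
  \<comment> \<open>Essentiality closes the cycle of implications, from which all equivalences
    follow.\<close>
  have 41: "essential_weight v \<longrightarrow> C4 \<longrightarrow> C1"
    using C1 kernel_decay_of_essential by (simp add: C4_def)
  show ?thesis using 12 23 34 41 by blast
qed

end
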